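(* For any $\rho>0$ and $c>0$, the sequence $\{(w^\nu,x^\nu,y^\nu)\}_{\nu=1}^\infty$ generated in $W\times X\times(\mathbb{R}^m)^K$ by the augmented decomposition algorithm (ADA) from any starting point converges to some $(\bar w,\bar x,\bar y)$ such that (a) $(\bar w,\bar x)$ solves problem (P$_w$), hence $\bar x$ solves problem (P); (b) $\bar y_1=\cdots=\bar y_K\in\mathbb{R}^m$, and this common multiplier vector solves the dual problem (D).
   Context: Problem (P): minimize $f(x)=f_1(x_1)+\cdots+f_K(x_K)$ subject to $Ex=E_1x_1+\cdots+E_Kx_K=q$, $x_k\in X_k$ ($k=1,\dots,K$), where $x=(x_1,\dots,x_K)\in\mathbb{R}^{n_1}\times\cdots\times\mathbb{R}^{n_K}=\mathbb{R}^n$, each $f_k$ is a closed proper convex function on $\mathbb{R}^{n_k}$ (possibly nonsmooth), each $X_k\subset\mathbb{R}^{n_k}$ is a closed convex set, $X=X_1\times\cdots\times X_K$, $E=(E_1,\dots,E_K)\in\mathbb{R}^{m\times n}$, $q\in\mathbb{R}^m$. Standing assumption. The global minimum of (P) is attained, and $\mathrm{int}(X)\cap\mathrm{dom} f\cap\{x: Ex=q\}\neq\emptyset$ (or, alternatively, if $X$ is polyhedral, $X\cap\mathrm{int}(\mathrm{dom} f)\cap\{x:Ex=q\}\ne\emptyset$); moreover the Lagrangian $L(x,y)=f(x)+\langle Ex-q,y\rangle$ has a saddle point, i.e. there are $\bar x\in X$, $\bar y\in\mathbb{R}^m$ with $\bar x\in\arg\min_{x\in X}L(x,\bar y)$ and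 $\bar y\in\arg\max_{y\in\mathbb{R}^m}L(\bar x,y)$. Problem (D): maximize $d(y)=\inf_{x\in X}\{f(x)+\langle y,Ex-q\rangle\}$ over $y\in\mathbb{R}^m$. Problem (P$_w$): minimize $f(x)$ over $(w,x)$ subject to $E_jx_j-w_j=0$ ($j=1,\dots,K-1$), $E_Kx_K-q-w_K=0$, $w_1+\cdots+w_K=0$, $x_k\in X_k$ ($k=1,\dots,K$). $W=\{w=(w_1,\dots,w_K)\in(\mathbb{R}^m)^K: w_1+\cdots+w_K=0\}$. ADA. Given $w^0\in W$, $x^0\in X$, $y^0\in(\mathbb{R}^m)^K$. Put $q_k=0$ for $k<K$ and $q_K=q$. For $\nu=0,1,2,\dots$ and $k=1,\dots,K$: $x_k^{\nu+1}=\arg\min_{x_k\in X_k}\{f_k(x_k)+\frac{\rho}{4}\|E_kx_k-q_k-w_k^\nu+\frac{2}{\rho}y_k^\nu\|_2^2+\frac{1}{2c}\|x_k-x_k^\nu\|_2^2\}$; $\eta_k^{\nu+1}=y_k^\nu+\frac{\rho}{2}[E_kx_k^{\nu+1}-q_k-w_k^\nu]$; $\zeta_k^{\nu+1}=\frac1K\sum_{j=1}^K\eta_j^{\nu+1}$; $w_k^{\nu+1}=w_k^\nu+\frac1\rho[\eta_k^{\nu+1}-\zeta_k^{\nu+1}]$; $y_k^{\nu+1}=\frac12[\eta_k^{\nu+1}+\zeta_k^{\nu+1}]$. *)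

theory Defs
  imports "HOL-Analysis.Analysis"
begin

text \<open>
  \<^bold>\<open>Product structure.\<close>  The blocks \<open>k = 1, \<dots>, K\<close> are the elements of a finite linearly ordered
  type \<open>'k\<close>; the last block \<open>K\<close> is its maximum.  The space \<open>R^n\<close> is \<open>real ^ 'n\<close>, and
  \<open>blk :: 'n \<Rightarrow> 'k\<close> tells to which block a coordinate belongs, so that \<open>R^n\<close> is the product of
  spaces \<open>R^(n_k)\<close> of arbitrary, possibly different, dimensions \<open>n_k = card {i. blk i = k}\<close>.
  The factor \<open>R^(n_k)\<close> is identified with the coordinate subspace of the vectors vanishing outside
  block \<open>k\<close>.  Under this identification norms agree, \<open>x_k\<close> is \<open>block blk k x\<close>, and, \<open>E_k\<close> being the
  submatrix of the columns of \<open>E\<close> in block \<open>k\<close>, the vector \<open>E_k x_k\<close> is \<open>E *v x_k\<close>.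
\<close>

definition block_space :: "('n::finite \<Rightarrow> 'k) \<Rightarrow> 'k \<Rightarrow> (real ^ 'n) set" where
  "block_space blk k = {z. \<forall>i. blk i \<noteq> k \<longrightarrow> z $ i = 0}"

definition block :: "('n::finite \<Rightarrow> 'k) \<Rightarrow> 'k \<Rightarrow> real ^ 'n \<Rightarrow> real ^ 'n" where
  "block blk k x = (\<chi> i. if blk i = k then x $ i else 0)"

definition prod_set :: "('n::finite \<Rightarrow> 'k) \<Rightarrow> ('k \<Rightarrow> (real ^ 'n) set) \<Rightarrow> (real ^ 'n) set" where
  "prod_set blk X = {x. \<forall>k. block blk k x \<in> X k}"

definition sep_fun :: "('n::finite \<Rightarrow> 'k::finite) \<Rightarrow> ('k \<Rightarrow> real ^ 'n \<Rightarrow> ereal) \<Rightarrow> real ^ 'n \<Rightarrow> ereal" where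
  "sep_fun blk f x = (\<Sum>k\<in>UNIV. f k (block blk k x))"

definition eff_dom :: "('a \<Rightarrow> ereal) \<Rightarrow> 'a set" where
  "eff_dom F = {x. F x < \<infinity>}"

text \<open>
  Extended-real-valued functions on a (closed) subspace \<open>V\<close>; the values outside \<open>V\<close> are irrelevant.
  A proper convex function is closed (equivalently, lower semicontinuous) iff its epigraph is closed.
\<close>

definition ereal_epigraph :: "'a set \<Rightarrow> ('a \<Rightarrow> ereal) \<Rightarrow> ('a \<times> real) set" where
  "ereal_epigraph V g = {(z, r). z \<in> V \<and> g z \<le> ereal r}"

definition closed_proper_convex_on :: "'a::euclidean_space set \<Rightarrow> ('a \<Rightarrow> ereal) \<Rightarrow> bool" where
  "closed_proper_convex_on V g \<longleftrightarrow>
     closed (ereal_epigraph V g) \<and> convex (ereal_epigraph V g) \<and>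
     (\<forall>z\<in>V. g z \<noteq> -\<infinity>) \<and> (\<exists>z\<in>V. g z \<noteq> \<infinity>)"

text \<open>
  \<^bold>\<open>Problems (P) and (D) and the Lagrangian\<close>, for an objective \<open>F\<close> and a constraint set \<open>S\<close>.
\<close>

definition solves_P ::
  "(real ^ 'n \<Rightarrow> ereal) \<Rightarrow> (real ^ 'n) set \<Rightarrow> real ^ 'n ^ 'm \<Rightarrow> real ^ 'm \<Rightarrow> real ^ 'n \<Rightarrow> bool" where
  "solves_P F S E q x \<longleftrightarrow> is_arg_min F (\<lambda>x'. x' \<in> S \<and> E *v x' = q) x"

definition lagrangian ::
  "(real ^ 'n \<Rightarrow> ereal) \<Rightarrow> real ^ 'n ^ 'm \<Rightarrow> real ^ 'm \<Rightarrow> real ^ 'n \<Rightarrow> real ^ 'm \<Rightarrow> ereal" where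
  "lagrangian F E q x y = F x + ereal ((E *v x - q) \<bullet> y)"

definition saddle_point ::
  "(real ^ 'n \<Rightarrow> ereal) \<Rightarrow> (real ^ 'n) set \<Rightarrow> real ^ 'n ^ 'm \<Rightarrow> real ^ 'm \<Rightarrow> real ^ 'n \<Rightarrow> real ^ 'm \<Rightarrow> bool" where
  "saddle_point F S E q x y \<longleftrightarrow>
     is_arg_min (\<lambda>x'. lagrangian F E q x' y) (\<lambda>x'. x' \<in> S) x \<and>
     is_arg_max (\<lambda>y'. lagrangian F E q x y') (\<lambda>_. True) y"

definition dual_fun ::
  "(real ^ 'n \<Rightarrow> ereal) \<Rightarrow> (real ^ 'n) set \<Rightarrow> real ^ 'n ^ 'm \<Rightarrow> real ^ 'm \<Rightarrow> real ^ 'm \<Rightarrow> ereal" where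
  "dual_fun F S E q y = (INF x\<in>S. F x + ereal (y \<bullet> (E *v x - q)))"

definition solves_D ::
  "(real ^ 'n \<Rightarrow> ereal) \<Rightarrow> (real ^ 'n) set \<Rightarrow> real ^ 'n ^ 'm \<Rightarrow> real ^ 'm \<Rightarrow> real ^ 'm \<Rightarrow> bool" where
  "solves_D F S E q y \<longleftrightarrow> is_arg_max (dual_fun F S E q) (\<lambda>_. True) y"

definition constraint_qualification ::
  "(real ^ 'n \<Rightarrow> ereal) \<Rightarrow> (real ^ 'n) set \<Rightarrow> real ^ 'n ^ 'm \<Rightarrow> real ^ 'm \<Rightarrow> bool" where
  "constraint_qualification F S E q \<longleftrightarrow>
     interior S \<inter> eff_dom F \<inter> {x. E *v x = q} \<noteq> {} \<or>
     (polyhedron S \<and> S \<inter> interior (eff_dom F) \<inter> {x. E *v x = q} \<noteq> {})"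

text \<open>\<^bold>\<open>The decomposed problem (P\<open>\<^sub>w\<close>).\<close>\<close>

definition W_space :: "((real ^ 'm) ^ 'k::finite) set" where
  "W_space = {w. (\<Sum>k\<in>UNIV. w $ k) = 0}"

definition feasible_Pw ::
  "('n::finite \<Rightarrow> 'k::{finite,linorder}) \<Rightarrow> (real ^ 'n) set \<Rightarrow> real ^ 'n ^ 'm \<Rightarrow> real ^ 'm \<Rightarrow>
   (real ^ 'm, 'k) vec \<times> (real ^ 'n) \<Rightarrow> bool" where
  "feasible_Pw blk S E q = (\<lambda>(w, x).
     (\<forall>j < Max UNIV. E *v block blk j x - w $ j = 0) \<and>
     E *v block blk (Max UNIV) x - q - w $ (Max UNIV) = 0 \<and>
     (\<Sum>k\<in>UNIV. w $ k) = 0 \<and>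
     x \<in> S)"

definition solves_Pw ::
  "('n::finite \<Rightarrow> 'k::{finite,linorder}) \<Rightarrow> (real ^ 'n \<Rightarrow> ereal) \<Rightarrow> (real ^ 'n) set \<Rightarrow>
   real ^ 'n ^ 'm \<Rightarrow> real ^ 'm \<Rightarrow> (real ^ 'm, 'k) vec \<Rightarrow> real ^ 'n \<Rightarrow> bool" where
  "solves_Pw blk F S E q w x \<longleftrightarrow>
     is_arg_min (\<lambda>(w', x'). F x') (feasible_Pw blk S E q) (w, x)"

text \<open>
  \<^bold>\<open>The algorithm.\<close>  \<open>arg_min\<close> is a choice operator, so a convergence statement about \<open>ada\<close> also
  requires that the subproblems are solvable.  The new point is assembled from its blocks by summation,
  in accordance with the embedding of the factors \<open>R^(n_k)\<close> into \<open>R^n\<close>.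
\<close>

definition q_part :: "real ^ 'm \<Rightarrow> 'k::{finite,linorder} \<Rightarrow> real ^ 'm" where
  "q_part q k = (if k = Max UNIV then q else 0)"

definition ada_block_min ::
  "('n::finite \<Rightarrow> 'k::{finite,linorder}) \<Rightarrow> ('k \<Rightarrow> real ^ 'n \<Rightarrow> ereal) \<Rightarrow> ('k \<Rightarrow> (real ^ 'n) set) \<Rightarrow>
   real ^ 'n ^ 'm \<Rightarrow> real ^ 'm \<Rightarrow> real \<Rightarrow> real \<Rightarrow>
   (real ^ 'm, 'k) vec \<Rightarrow> real ^ 'n \<Rightarrow> (real ^ 'm, 'k) vec \<Rightarrow> 'k \<Rightarrow> real ^ 'n" where
  "ada_block_min blk f X E q \<rho> c w x y k =
     arg_min (\<lambda>z. f k z + ereal (\<rho> / 4 * (norm (E *v z - q_part q k - w $ k + (2 / \<rho>) *\<^sub>R y $ k))\<^sup>2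
                                 + 1 / (2 * c) * (norm (z - block blk k x))\<^sup>2))
             (\<lambda>z. z \<in> X k)"

definition ada_step ::
  "('n::finite \<Rightarrow> 'k::{finite,linorder}) \<Rightarrow> ('k \<Rightarrow> real ^ 'n \<Rightarrow> ereal) \<Rightarrow> ('k \<Rightarrow> (real ^ 'n) set) \<Rightarrow>
   real ^ 'n ^ 'm \<Rightarrow> real ^ 'm \<Rightarrow> real \<Rightarrow> real \<Rightarrow>
   (real ^ 'm, 'k) vec \<times> (real ^ 'n) \<times> (real ^ 'm, 'k) vec \<Rightarrow>
   (real ^ 'm, 'k) vec \<times> (real ^ 'n) \<times> (real ^ 'm, 'k) vec" where
  "ada_step blk f X E q \<rho> c = (\<lambda>(w, x, y).
     let x' = (\<Sum>k\<in>UNIV. ada_block_min blk f X E q \<rho> c w x y k);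
         \<eta> = (\<chi> k. y $ k + (\<rho> / 2) *\<^sub>R (E *v block blk k x' - q_part q k - w $ k));
         \<zeta> = (\<chi> k. (1 / real CARD('k)) *\<^sub>R (\<Sum>j\<in>UNIV. \<eta> $ j));
         w' = (\<chi> k. w $ k + (1 / \<rho>) *\<^sub>R (\<eta> $ k - \<zeta> $ k));
         y' = (\<chi> k. (1 / 2) *\<^sub>R (\<eta> $ k + \<zeta> $ k))
     in (w', x', y'))"

definition ada ::
  "('n::finite \<Rightarrow> 'k::{finite,linorder}) \<Rightarrow> ('k \<Rightarrow> real ^ 'n \<Rightarrow> ereal) \<Rightarrow> ('k \<Rightarrow> (real ^ 'n) set) \<Rightarrow>
   real ^ 'n ^ 'm \<Rightarrow> real ^ 'm \<Rightarrow> real \<Rightarrow> real \<Rightarrow>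
   (real ^ 'm, 'k) vec \<times> (real ^ 'n) \<times> (real ^ 'm, 'k) vec \<Rightarrow> nat \<Rightarrow>
   (real ^ 'm, 'k) vec \<times> (real ^ 'n) \<times> (real ^ 'm, 'k) vec" where
  "ada blk f X E q \<rho> c s0 \<nu> = (ada_step blk f X E q \<rho> c ^^ \<nu>) s0"

end

theory Submission
  imports Defs
begin

text \<open>
  Let \<open>A x = (E_1 x_1, \<dots>, E_K x_K)\<close>, \<open>b = (q_1, \<dots>, q_K)\<close> and let \<open>P\<close> be the orthogonal projection onto
  \<open>W\<close>, so that the complement of \<open>W\<close> is the diagonal.  Then \<open>\<eta> - \<zeta> = P \<eta>\<close>, and comparing the optimality
  condition of the \<open>x\<close>-step with the one of a saddle point \<open>(wb, xb, yb)\<close> shows that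
  \<open>|y - yb|\<^sup>2 / \<rho> + \<rho> |w - wb|\<^sup>2 / 2 + |P y|\<^sup>2 / \<rho> + |x - xb|\<^sup>2 / (2 c)\<close> decreases by at least
  \<open>|y' - y|\<^sup>2 / \<rho> + \<rho> |w' - w|\<^sup>2 / 2 + |x' - x|\<^sup>2 / (2 c)\<close> in each step.  So the iterates are bounded and
  their increments vanish, every cluster point is again a saddle point, and monotonicity relative to
  that cluster point gives convergence of the whole sequence.
\<close>

section \<open>Proximal minimization of a convex function\<close>

text \<open>Divide by \<open>t\<close> and let \<open>t\<close> decrease to 0.\<close>

lemma nonneg_if_quadratic_nonneg:
  fixes a b :: real
  assumes "\<And>t. 0 < t \<Longrightarrow> t < 1 \<Longrightarrow> 0 \<le> t * a + t\<^sup>2 * b"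
  shows "0 \<le> a"
proof (rule tendsto_lowerbound)
  show "((\<lambda>t. a + t * b) \<longlongrightarrow> a) (at_right 0)"
    by (auto intro!: tendsto_eq_intros)
  have "0 \<le> a + t * b" if "0 < t" "t < 1" for t
  proof -
    have "0 \<le> t * (a + t * b)"
      using assms[OF that] by (simp add: power2_eq_square algebra_simps)
    then show ?thesis using that by (simp add: zero_le_mult_iff)
  qed
  then show "\<forall>\<^sub>F t in at_right 0. 0 \<le> a + t * b"
    by (auto simp: eventually_at_right_field intro!: exI[of _ 1])
qed simp

text \<open>Moving from \<open>u\<close> a fraction \<open>t\<close> towards \<open>z\<close>
  changes the squares by a polynomial in \<open>t\<close>, and \<open>g\<close> by at most its
  linear interpolation; minimality makes the coefficient of \<open>t\<close> nonnegative. This is a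
  first-order condition in which \<open>g z - g u\<close> replaces a subgradient.\<close>

lemma proximal_optimality:
  fixes g :: "'a::real_inner \<Rightarrow> real" and A :: "'a \<Rightarrow> 'b::real_inner"
  assumes conv: "convex_on C g" and lin: "linear A" and u: "u \<in> C" and z: "z \<in> C"
    and min: "\<And>z. z \<in> C \<Longrightarrow> g u + \<alpha> * (norm (A u - b))\<^sup>2 + \<beta> * (norm (u - a))\<^sup>2
      \<le> g z + \<alpha> * (norm (A z - b))\<^sup>2 + \<beta> * (norm (z - a))\<^sup>2"
  shows "g u \<le> g z + 2 * \<alpha> * ((A u - b) \<bullet> (A z - A u)) + 2 * \<beta> * ((u - a) \<bullet> (z - u))"
proof -
  let ?a = "g z - g u + 2 * \<alpha> * ((A u - b) \<bullet> (A z - A u)) + 2 * \<beta> * ((u - a) \<bullet> (z - u))"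
  let ?b = "\<alpha> * (norm (A z - A u))\<^sup>2 + \<beta> * (norm (z - u))\<^sup>2"
  have "0 \<le> ?a"
  proof (rule nonneg_if_quadratic_nonneg[where b = ?b])
    fix t :: real
    assume t: "0 < t" "t < 1"
    let ?z = "(1 - t) *\<^sub>R u + t *\<^sub>R z"
    have zC: "?z \<in> C"
      using conv u z t by (intro convexD) (auto simp: convex_on_def)
    have g: "g ?z \<le> (1 - t) * g u + t * g z"
      using conv u z t by (intro convex_onD) auto
    have "A ?z - b = (A u - b) + t *\<^sub>R (A z - A u)"
      using lin by (simp add: linear_add linear_diff linear_scale algebra_simps
          del: scaleR_left_diff_distrib) (simp add: algebra_simps)
    then have e1: "(norm (A ?z - b))\<^sup>2
        = (norm (A u - b))\<^sup>2 + t * (2 * ((A u - b) \<bullet> (A z - A u))) + t\<^sup>2 * (norm (A z - A u))\<^sup>2"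
      by (simp only: power2_norm_eq_inner)
        (simp add: inner_add_left inner_add_right power2_eq_square inner_commute algebra_simps)
    have "?z - a = (u - a) + t *\<^sub>R (z - u)"
      by (simp add: algebra_simps)
    then have e2: "(norm (?z - a))\<^sup>2
        = (norm (u - a))\<^sup>2 + t * (2 * ((u - a) \<bullet> (z - u))) + t\<^sup>2 * (norm (z - u))\<^sup>2"
      by (simp only: power2_norm_eq_inner)
        (simp add: inner_add_left inner_add_right power2_eq_square inner_commute algebra_simps)
    show "0 \<le> t * ?a + t\<^sup>2 * ?b"
      using min[OF zC] g unfolding e1 e2 by (simp add: algebra_simps)
  qed
  then show ?thesis by simp
qed

text \<open>The minorant lets \<open>g\<close> decrease at most linearly, so the term with \<beta>
  makes sublevel sets bounded. The minimum is sought over the epigraph rather than over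
  \<open>C\<close>: \<open>g\<close> need not be continuous and \<open>C\<close> need not be closed,
  whereas \<open>r + h z\<close> is continuous on a closed set of pairs
  \<open>(z, r)\<close>.\<close>

lemma proximal_minimizer_exists:
  fixes g :: "'a::euclidean_space \<Rightarrow> real" and A :: "'a \<Rightarrow> 'b::euclidean_space"
  assumes clo: "closed {(z, r). z \<in> C \<and> g z \<le> r}" and lin: "linear A"
    and xb: "xb \<in> C" and minorant: "\<And>z. z \<in> C \<Longrightarrow> g xb + A xb \<bullet> yb \<le> g z + A z \<bullet> yb"
    and pos: "\<alpha> > 0" "\<beta> > 0"
  obtains u where "u \<in> C" "\<And>z. z \<in> C \<Longrightarrow> g u + \<alpha> * (norm (A u - b))\<^sup>2 + \<beta> * (norm (u - a))\<^sup>2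
      \<le> g z + \<alpha> * (norm (A z - b))\<^sup>2 + \<beta> * (norm (z - a))\<^sup>2"
proof -
  define h where "h z = \<alpha> * (norm (A z - b))\<^sup>2 + \<beta> * (norm (z - a))\<^sup>2" for z
  define M where "M = g xb + h xb"
  define T where "T = {(z, r). z \<in> C \<and> g z \<le> r} \<inter> {p. snd p + h (fst p) \<le> M}"
  have contA: "continuous_on UNIV A"
    using lin by (simp add: linear_continuous_on linear_conv_bounded_linear)
  have conth: "continuous_on UNIV (\<lambda>p :: 'a \<times> real. snd p + h (fst p))"
    unfolding h_def
    by (intro continuous_intros continuous_on_compose2[OF contA]) auto
  have "closed T"
    unfolding T_def using clo conth
    by (intro closed_Int closed_Collect_le) auto
  moreover have "bounded T"
  proof -
    obtain B where B: "B > 0" "\<And>z. norm (A z) \<le> B * norm z"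
      using linear_bounded_pos[OF lin] by blast
    define L where "L = B * norm yb"
    define N where "N = \<bar>M\<bar> + \<bar>g xb\<bar> + L * norm (a - xb)"
    have L: "L \<ge> 0" using B by (simp add: L_def)
    have low: "g xb - L * norm (a - xb) - L * norm (z - a) \<le> g z" if "z \<in> C" for z
    proof -
      have "A (z - xb) \<bullet> yb \<le> norm (A (z - xb)) * norm yb"
        by (rule norm_cauchy_schwarz)
      also have "\<dots> \<le> L * norm (z - xb)"
        unfolding L_def using mult_right_mono[OF B(2)[of "z - xb"], of "norm yb"]
        by (simp add: mult_ac)
      also have "\<dots> \<le> L * (norm (z - a) + norm (a - xb))"
        using L norm_triangle_ineq[of "z - a" "a - xb"] by (intro mult_left_mono) auto
      finally show ?thesis
        using minorant[OF that] lin by (simp add: linear_diff inner_diff_left algebra_simps)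
    qed
    \<comment> \<open>A number \<open>n\<close> with \<beta> \<open>n^2\<close> \<le>
      \<open>N + L n\<close> cannot exceed \<open>R\<close>. The summand \<beta> in the numerator
      gives \<open>R\<close> \<ge> 1, so \<open>n > R\<close> implies \<open>n > 1\<close>, hence
      \<open>N + L n\<close> \<le> \<open>(L + N) n\<close> < \<beta> \<open>n^2\<close>.\<close>
    define R where "R = (L + N + \<beta>) / \<beta>"
    have N: "N \<ge> 0" using L by (simp add: N_def)
    have R: "norm (z - a) \<le> R \<and> \<bar>r\<bar> \<le> N + L * R" if "(z, r) \<in> T" for z r
    proof -
      let ?n = "norm (z - a)"
      have z: "z \<in> C" "g z \<le> r" and r: "r + h z \<le> M" using that by (auto simp: T_def)
      have h: "\<beta> * ?n\<^sup>2 \<le> h z" "0 \<le> h z" using pos by (simp_all add: h_def)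
      have 1: "\<beta> * ?n\<^sup>2 \<le> N + L * ?n"
        using low[OF z(1)] z r h unfolding N_def by linarith
      have n: "?n \<le> R"
      proof (rule ccontr)
        assume "\<not> ?n \<le> R"
        then have gt: "L + N + \<beta> < \<beta> * ?n"
          using pos by (simp add: R_def not_le pos_divide_less_eq mult.commute)
        then have "\<beta> * 1 < \<beta> * ?n" using L N by linarith
        then have n1: "1 < ?n" using pos by (subst (asm) mult_less_cancel_left_pos) auto
        have "(L + N) * ?n \<le> (L + N + \<beta>) * ?n"
          using pos by (intro mult_right_mono) auto
        also have "\<dots> < \<beta> * ?n * ?n"
          using gt n1 by (intro mult_strict_right_mono) auto
        finally have "(L + N) * ?n < \<beta> * ?n\<^sup>2" by (simp add: power2_eq_square mult.assoc)
        moreover have "N * 1 \<le> N * ?n" using N n1 by (intro mult_left_mono) auto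
        ultimately show False using 1 by (simp add: algebra_simps)
      qed
      have "L * ?n \<le> L * R" using L n by (intro mult_left_mono)
      then have "\<bar>r\<bar> \<le> N + L * R"
        using low[OF z(1)] z r h N L unfolding N_def by (simp add: abs_le_iff) (smt (verit) mult_nonneg_nonneg norm_ge_zero)
      with n show ?thesis by simp
    qed
    have "T \<subseteq> cball a R \<times> cball 0 (N + L * R)"
      using R by (auto simp: dist_norm norm_minus_commute)
    then show ?thesis
      by (rule bounded_subset[rotated]) (intro bounded_Times bounded_cball)
  qed
  ultimately have "compact T" by (simp add: compact_eq_bounded_closed)
  moreover have "(xb, g xb) \<in> T" using xb by (simp add: T_def M_def)
  ultimately obtain p where p: "p \<in> T" "\<And>p'. p' \<in> T \<Longrightarrow> snd p + h (fst p) \<le> snd p' + h (fst p')"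
    using continuous_attains_inf[of T "\<lambda>p. snd p + h (fst p)"] conth
    by (metis (no_types, lifting) continuous_on_subset empty_iff subset_UNIV)
  show ?thesis
  proof
    show "fst p \<in> C" using p(1) by (auto simp: T_def)
    fix z assume z: "z \<in> C"
    have "g (fst p) \<le> snd p" "snd p + h (fst p) \<le> M" using p(1) by (auto simp: T_def)
    \<comment> \<open>Only points with value at most \<open>M\<close> have their graph point in
      \<open>T\<close>; the others lie above \<open>M\<close>, which bounds the value at
      \<open>p\<close>.\<close>
    moreover have "snd p + h (fst p) \<le> g z + h z" if "g z + h z \<le> M"
      using p(2)[of "(z, g z)"] that z by (simp add: T_def)
    ultimately have "g (fst p) + h (fst p) \<le> g z + h z" by linarith
    then show "g (fst p) + \<alpha> * (norm (A (fst p) - b))\<^sup>2 + \<beta> * (norm (fst p - a))\<^sup>2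
      \<le> g z + \<alpha> * (norm (A z - b))\<^sup>2 + \<beta> * (norm (z - a))\<^sup>2"
      by (simp add: h_def algebra_simps)
  qed
qed

section \<open>Squared norms and sequences\<close>

text \<open>Turns the inner products of an optimality condition into a telescoping difference of
  squared distances plus a squared increment.\<close>

lemma norm_sq_diff_telescope:
  fixes p p' q :: "'a::real_inner"
  shows "2 * ((p' - p) \<bullet> (p' - q)) = (norm (p' - q))\<^sup>2 - (norm (p - q))\<^sup>2 + (norm (p' - p))\<^sup>2"
  unfolding power2_norm_eq_inner
  by (simp add: inner_diff_left inner_diff_right inner_commute algebra_simps)

lemma tendsto_zero_if_weighted_sq_le:
  fixes u :: "nat \<Rightarrow> 'a::real_normed_vector"
  assumes "e \<longlonglongrightarrow> 0" and "a > 0" and "\<And>n. a * (norm (u n))\<^sup>2 \<le> e n"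
  shows "u \<longlonglongrightarrow> 0"
proof -
  have "(\<lambda>n. (norm (u n))\<^sup>2) \<longlonglongrightarrow> 0"
  proof (rule tendsto_sandwich[where f = "\<lambda>_. 0"])
    show "(\<lambda>n. e n / a) \<longlonglongrightarrow> 0" using tendsto_divide[OF assms(1) tendsto_const, of a] assms(2) by simp
    show "\<forall>\<^sub>F n in sequentially. (norm (u n))\<^sup>2 \<le> e n / a"
      using assms(2,3) by (simp add: pos_le_divide_eq mult.commute)
  qed auto
  then show ?thesis
    using tendsto_real_sqrt by (fastforce intro: tendsto_norm_zero_cancel)
qed

lemma bounded_if_weighted_sq_le:
  fixes u :: "nat \<Rightarrow> 'a::real_normed_vector"
  assumes "a > 0" and "\<And>n. a * (norm (u n - l))\<^sup>2 \<le> M"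
  shows "bounded (range u)"
proof -
  have "norm (u n - l) \<le> sqrt (M / a)" for n
    using assms by (intro real_le_rsqrt) (simp add: field_simps)
  then have "range u \<subseteq> cball l (sqrt (M / a))" by (auto simp: dist_norm norm_minus_commute)
  then show ?thesis using bounded_cball bounded_subset by blast
qed

section \<open>The iteration for an abstract projection\<close>

text \<open>Extended reals and blocks are hidden here: \<open>C\<close> stands for the points of the
  constraint set with finite objective, and \<open>P_in\<close> with \<open>P_orth\<close> says that
  \<open>P\<close> is the orthogonal projection onto \<open>W\<close>. As \<zeta> equals \<eta>
  minus its projection, the average of \<eta> and \<zeta> takes the form in
  \<open>y_Suc\<close>.\<close>

locale augmented_decomposition =
  fixes C :: "'a::euclidean_space set" and g :: "'a \<Rightarrow> real"
    and A :: "'a \<Rightarrow> 'b::euclidean_space" and W :: "'b set" and P :: "'b \<Rightarrow> 'b" and b :: 'b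
    and \<rho> c :: real and w y \<eta> :: "nat \<Rightarrow> 'b" and x :: "nat \<Rightarrow> 'a"
  assumes conv: "convex_on C g" and clo: "closed {(z, r). z \<in> C \<and> g z \<le> r}"
    and linA: "linear A" and linP: "linear P" and subW: "subspace W"
    and P_in: "\<And>z. P z \<in> W" and P_orth: "\<And>z u. u \<in> W \<Longrightarrow> (z - P z) \<bullet> u = 0"
    and rho: "\<rho> > 0" and c: "c > 0" and w0: "w 0 \<in> W"
    and x_in: "\<And>n. x (Suc n) \<in> C"
    and x_min: "\<And>n z. z \<in> C \<Longrightarrow>
      g (x (Suc n)) + \<rho> / 4 * (norm (A (x (Suc n)) - (b + w n - (2 / \<rho>) *\<^sub>R y n)))\<^sup>2
        + 1 / (2 * c) * (norm (x (Suc n) - x n))\<^sup>2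
      \<le> g z + \<rho> / 4 * (norm (A z - (b + w n - (2 / \<rho>) *\<^sub>R y n)))\<^sup>2
        + 1 / (2 * c) * (norm (z - x n))\<^sup>2"
    and eta: "\<And>n. \<eta> n = y n + (\<rho> / 2) *\<^sub>R (A (x (Suc n)) - b - w n)"
    and w_Suc: "\<And>n. w (Suc n) = w n + (1 / \<rho>) *\<^sub>R P (\<eta> n)"
    and y_Suc: "\<And>n. y (Suc n) = \<eta> n - (1 / 2) *\<^sub>R P (\<eta> n)"
begin

text \<open>Saddle point conditions for minimizing \<open>g x\<close> subject to
  \<open>A x - b = w\<close> with \<open>w\<close> in \<open>W\<close>. Orthogonality of
  \<open>yb\<close> to \<open>W\<close> is stationarity of the Lagrangian in \<open>w\<close>; the
  last clause is its minimality in \<open>x\<close>.\<close>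

definition kkt :: "'b \<Rightarrow> 'a \<Rightarrow> 'b \<Rightarrow> bool" where
  "kkt wb xb yb \<longleftrightarrow> wb \<in> W \<and> xb \<in> C \<and> A xb - b = wb \<and> (\<forall>u\<in>W. yb \<bullet> u = 0) \<and>
     (\<forall>z\<in>C. g xb + A xb \<bullet> yb \<le> g z + A z \<bullet> yb)"

text \<open>
  The term in \<open>P (y n)\<close> absorbs the cross term of \<open>w (Suc n) - w n\<close> and \<open>y (Suc n) - y n\<close>, which is
  present because the \<open>x\<close>-step uses the old \<open>w n\<close>; it telescopes since
  \<open>P (y (Suc n)) = \<rho> / 2 *\<^sub>R (w (Suc n) - w n)\<close>.
\<close>

definition lyapunov :: "'b \<Rightarrow> 'a \<Rightarrow> 'b \<Rightarrow> nat \<Rightarrow> real" where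
  "lyapunov wb xb yb n = 1 / \<rho> * (norm (y n - yb))\<^sup>2 + \<rho> / 2 * (norm (w n - wb))\<^sup>2
     + 1 / \<rho> * (norm (P (y n)))\<^sup>2 + 1 / (2 * c) * (norm (x n - xb))\<^sup>2"

lemma P_idem: "P (P z) = P z"
proof -
  have "P z - P (P z) \<in> W" using P_in subW by (simp add: subspace_diff)
  then have "(P z - P (P z)) \<bullet> (P z - P (P z)) = 0" by (rule P_orth)
  then show ?thesis by simp
qed

lemma P_y_Suc: "P (y (Suc n)) = (\<rho> / 2) *\<^sub>R (w (Suc n) - w n)"
proof -
  have "P (y (Suc n)) = (1 - 1 / 2) *\<^sub>R P (\<eta> n)"
    unfolding y_Suc scaleR_left_diff_distrib using linP by (simp add: linear_diff linear_scale P_idem)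
  then show ?thesis using rho by (simp add: w_Suc)
qed

lemma w_in: "w n \<in> W"
  by (induction n) (simp_all add: w0 w_Suc P_in subW subspace_add subspace_scale)

lemma eta_eq: "\<eta> n = y (Suc n) + P (y (Suc n))"
proof -
  have "P (y (Suc n)) = (1 / 2) *\<^sub>R P (\<eta> n)"
    using rho by (simp add: P_y_Suc w_Suc)
  then show ?thesis by (simp add: y_Suc)
qed

text \<open>By \<open>eta_eq\<close>, \<open>\<eta> n - y n\<close> is
  \<open>y (Suc n) - y n\<close> plus \<open>P (y (Suc n))\<close>, and the latter is the amount
  that turns \<open>w n\<close> into \<open>w (Suc n)\<close>. So the infeasibility of the new
  iterate is a multiple of the increment of \<open>y\<close>.\<close>

lemma residual: "A (x (Suc n)) - b = (2 / \<rho>) *\<^sub>R (y (Suc n) - y n) + w (Suc n)"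
proof -
  have "A (x (Suc n)) - b - w n = (2 / \<rho>) *\<^sub>R (\<eta> n - y n)"
    using rho by (simp add: eta)
  then have "A (x (Suc n)) - b = (2 / \<rho>) *\<^sub>R (y (Suc n) - y n) + (2 / \<rho>) *\<^sub>R P (y (Suc n)) + w n"
    by (simp add: eta_eq algebra_simps)
  then show ?thesis using rho by (simp add: P_y_Suc)
qed

text \<open>The factor \<rho>/4 of the penalty, the 2 from differentiation and the scaling 2/\<rho>
  of its argument cancel: \<open>\<eta> n\<close> is exactly the multiplier for which the new
  \<open>x\<close> is optimal up to the proximal term.\<close>

lemma x_optimality:
  assumes "z \<in> C"
  shows "g (x (Suc n)) \<le> g z + \<eta> n \<bullet> (A z - A (x (Suc n)))
    + (1 / c) * ((x (Suc n) - x n) \<bullet> (z - x (Suc n)))"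
proof -
  have "A (x (Suc n)) - (b + w n - (2 / \<rho>) *\<^sub>R y n) = (2 / \<rho>) *\<^sub>R \<eta> n"
    using rho by (simp add: eta algebra_simps)
  then show ?thesis
    using proximal_optimality[OF conv linA x_in assms x_min, of n] rho c by simp
qed

lemma lyapunov_descent:
  assumes "kkt wb xb yb"
  shows "lyapunov wb xb yb (Suc n) + 1 / \<rho> * (norm (y (Suc n) - y n))\<^sup>2
    + \<rho> / 2 * (norm (w (Suc n) - w n))\<^sup>2 + 1 / (2 * c) * (norm (x (Suc n) - x n))\<^sup>2
    \<le> lyapunov wb xb yb n"
proof -
  let ?x' = "x (Suc n)" and ?w' = "w (Suc n)" and ?y' = "y (Suc n)"
  define D where "D = ?w' - w n"
  have k: "wb \<in> W" "xb \<in> C" "A xb - b = wb" "\<And>u. u \<in> W \<Longrightarrow> yb \<bullet> u = 0"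
    "\<And>z. z \<in> C \<Longrightarrow> g xb + A xb \<bullet> yb \<le> g z + A z \<bullet> yb"
    using assms by (auto simp: kkt_def)
  have PD: "P ?y' = (\<rho> / 2) *\<^sub>R D" by (simp add: P_y_Suc D_def)
  have DW: "D \<in> W" "?w' - wb \<in> W" using w_in k(1) subW by (simp_all add: D_def subspace_diff)
  \<comment> \<open>Optimality of the new iterate tested at \<open>xb\<close> and optimality of
    \<open>xb\<close> tested at the new iterate are added, which cancels \<open>g\<close>.\<close>
  have "(\<eta> n - yb) \<bullet> (A ?x' - A xb) + (1 / c) * ((?x' - x n) \<bullet> (?x' - xb)) \<le> 0"
    using x_optimality[OF k(2), of n] k(5)[OF x_in[of n]]
    by (simp add: inner_diff_left inner_diff_right inner_commute algebra_simps)
  moreover have "A ?x' - A xb = (2 / \<rho>) *\<^sub>R (?y' - y n) + (?w' - wb)"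
    using residual[of n] k(3) by (simp add: algebra_simps)
  moreover have "\<eta> n - yb = (?y' - yb) + (\<rho> / 2) *\<^sub>R D"
    by (simp add: eta_eq PD)
  ultimately have "((?y' - yb) + (\<rho> / 2) *\<^sub>R D) \<bullet> ((2 / \<rho>) *\<^sub>R (?y' - y n) + (?w' - wb))
      + (1 / c) * ((?x' - x n) \<bullet> (?x' - xb)) \<le> 0"
    by simp
  then have main: "(2 / \<rho>) * ((?y' - yb) \<bullet> (?y' - y n)) + (?y' - yb) \<bullet> (?w' - wb) + D \<bullet> (?y' - y n)
      + (\<rho> / 2) * (D \<bullet> (?w' - wb)) + (1 / c) * ((?x' - x n) \<bullet> (?x' - xb)) \<le> 0"
    using rho by (simp only: inner_add_left inner_add_right inner_scaleR_left inner_scaleR_right)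
      (simp add: algebra_simps)
  \<comment> \<open>As \<open>?w' - wb\<close> lies in \<open>W\<close>, \<open>yb\<close> drops out
    and only the projection of \<open>?y'\<close> counts. The term becomes a second copy of the
    \<open>w\<close> term, which supplies the factor 2 for telescoping.\<close>
  have "(?y' - yb) \<bullet> (?w' - wb) = P ?y' \<bullet> (?w' - wb)"
    using P_orth[OF DW(2), of ?y'] k(4)[OF DW(2)] by (simp add: inner_diff_left)
  then have 1: "(?y' - yb) \<bullet> (?w' - wb) = \<rho> / 2 * (D \<bullet> (?w' - wb))" by (simp add: PD)
  \<comment> \<open>The cross term: \<open>D\<close> lies in \<open>W\<close> and is itself a
    multiple of \<open>P ?y'\<close>, so only projections remain. The subtracted 0 matches
    \<open>norm_sq_diff_telescope\<close> with reference point 0.\<close>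
  have "(?y' - y n) \<bullet> D = (P ?y' - P (y n)) \<bullet> D"
    using P_orth[OF DW(1), of ?y'] P_orth[OF DW(1), of "y n"] by (simp add: inner_diff_left)
  moreover have "D = (2 / \<rho>) *\<^sub>R P ?y'" using rho by (simp add: PD)
  ultimately have 2: "D \<bullet> (?y' - y n) = (1 / \<rho>) * (2 * ((P ?y' - P (y n)) \<bullet> (P ?y' - 0)))"
    by (simp add: inner_commute)
  have "(1 / \<rho>) * (2 * ((?y' - y n) \<bullet> (?y' - yb))) + (\<rho> / 2) * (2 * (D \<bullet> (?w' - wb)))
      + (1 / \<rho>) * (2 * ((P ?y' - P (y n)) \<bullet> (P ?y' - 0)))
      + 1 / (2 * c) * (2 * ((?x' - x n) \<bullet> (?x' - xb))) \<le> 0"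
    using main unfolding 1 2 by (simp add: inner_commute)
  then have "(1 / \<rho>) * ((norm (?y' - yb))\<^sup>2 - (norm (y n - yb))\<^sup>2 + (norm (?y' - y n))\<^sup>2)
      + (\<rho> / 2) * ((norm (?w' - wb))\<^sup>2 - (norm (w n - wb))\<^sup>2 + (norm (?w' - w n))\<^sup>2)
      + (1 / \<rho>) * ((norm (P ?y' - 0))\<^sup>2 - (norm (P (y n) - 0))\<^sup>2 + (norm (P ?y' - P (y n)))\<^sup>2)
      + 1 / (2 * c) * ((norm (?x' - xb))\<^sup>2 - (norm (x n - xb))\<^sup>2 + (norm (?x' - x n))\<^sup>2) \<le> 0"
    unfolding D_def norm_sq_diff_telescope .
  \<comment> \<open>The squared increment of \<open>P (y n)\<close> is discarded; the other three
    increments form the guaranteed decrease.\<close>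
  moreover have "0 \<le> (1 / \<rho>) * (norm (P ?y' - P (y n)))\<^sup>2" using rho by simp
  ultimately show ?thesis
    unfolding lyapunov_def by (simp only: ring_distribs diff_zero)
qed

lemma lyapunov_nonneg: "0 \<le> lyapunov wb xb yb n"
  using rho c by (simp add: lyapunov_def)

lemma lyapunov_decseq: "kkt wb xb yb \<Longrightarrow> decseq (lyapunov wb xb yb)"
  using rho c by (intro decseq_SucI order_trans[OF _ lyapunov_descent]) auto

lemma lyapunov_zeroD:
  assumes "lyapunov wb xb yb \<longlonglongrightarrow> 0"
  shows "w \<longlonglongrightarrow> wb" "x \<longlonglongrightarrow> xb" "y \<longlonglongrightarrow> yb"
proof -
  have "(\<lambda>n. w n - wb) \<longlonglongrightarrow> 0"
    by (rule tendsto_zero_if_weighted_sq_le[OF assms, of "\<rho> / 2"]) (use rho c in \<open>auto simp: lyapunov_def\<close>)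
  then show "w \<longlonglongrightarrow> wb" by (simp add: LIM_zero_iff)
  have "(\<lambda>n. x n - xb) \<longlonglongrightarrow> 0"
    by (rule tendsto_zero_if_weighted_sq_le[OF assms, of "1 / (2 * c)"]) (use rho c in \<open>auto simp: lyapunov_def\<close>)
  then show "x \<longlonglongrightarrow> xb" by (simp add: LIM_zero_iff)
  have "(\<lambda>n. y n - yb) \<longlonglongrightarrow> 0"
    by (rule tendsto_zero_if_weighted_sq_le[OF assms, of "1 / \<rho>"]) (use rho c in \<open>auto simp: lyapunov_def\<close>)
  then show "y \<longlonglongrightarrow> yb" by (simp add: LIM_zero_iff)
qed

section \<open>Limits of the abstract iteration\<close>

lemma differences_tendsto_zero:
  assumes "kkt wb xb yb"
  shows "(\<lambda>n. w (Suc n) - w n) \<longlonglongrightarrow> 0" "(\<lambda>n. x (Suc n) - x n) \<longlonglongrightarrow> 0"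
    "(\<lambda>n. y (Suc n) - y n) \<longlonglongrightarrow> 0"
proof -
  let ?L = "lyapunov wb xb yb"
  obtain l where l: "?L \<longlonglongrightarrow> l"
    by (rule decseq_convergent[OF lyapunov_decseq[OF assms], of 0]) (simp_all add: lyapunov_nonneg)
  then have e: "(\<lambda>n. ?L n - ?L (Suc n)) \<longlonglongrightarrow> 0"
    using tendsto_diff[OF l LIMSEQ_Suc[OF l]] by simp
  have D: "1 / \<rho> * (norm (y (Suc n) - y n))\<^sup>2
    + \<rho> / 2 * (norm (w (Suc n) - w n))\<^sup>2 + 1 / (2 * c) * (norm (x (Suc n) - x n))\<^sup>2
    \<le> ?L n - ?L (Suc n)" for n
    using lyapunov_descent[OF assms, of n] by linarith
  have pos: "0 \<le> 1 / \<rho> * (norm (y (Suc n) - y n))\<^sup>2" "0 \<le> \<rho> / 2 * (norm (w (Suc n) - w n))\<^sup>2"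
    "0 \<le> 1 / (2 * c) * (norm (x (Suc n) - x n))\<^sup>2" for n
    using rho c by simp_all
  have le: "\<rho> / 2 * (norm (w (Suc n) - w n))\<^sup>2 \<le> ?L n - ?L (Suc n)"
    "1 / (2 * c) * (norm (x (Suc n) - x n))\<^sup>2 \<le> ?L n - ?L (Suc n)"
    "1 / \<rho> * (norm (y (Suc n) - y n))\<^sup>2 \<le> ?L n - ?L (Suc n)" for n
    using D[of n] pos[of n] by linarith+
  show "(\<lambda>n. w (Suc n) - w n) \<longlonglongrightarrow> 0" "(\<lambda>n. x (Suc n) - x n) \<longlonglongrightarrow> 0"
    "(\<lambda>n. y (Suc n) - y n) \<longlonglongrightarrow> 0"
    using tendsto_zero_if_weighted_sq_le[OF e _ le(1)] tendsto_zero_if_weighted_sq_le[OF e _ le(2)]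
      tendsto_zero_if_weighted_sq_le[OF e _ le(3)] rho c by simp_all
qed

text \<open>Vanishing increments give the shifted indices \<open>Suc (r n)\<close> the same limits
  as \<open>r n\<close>, so each relation between consecutive iterates passes to the limit.\<close>

lemma cluster_point_kkt:
  assumes kkt: "kkt w0 x0 y0" and r: "strict_mono r"
    and wl: "(w \<circ> r) \<longlonglongrightarrow> wb" and xl: "(x \<circ> r) \<longlonglongrightarrow> xb" and yl: "(y \<circ> r) \<longlonglongrightarrow> yb"
  shows "kkt wb xb yb"
proof -
  have sub: "(\<lambda>n. f (r n)) \<longlonglongrightarrow> 0" if "f \<longlonglongrightarrow> 0" for f :: "nat \<Rightarrow> 'c::real_normed_vector"
    using LIMSEQ_subseq_LIMSEQ[OF that r] by (simp add: o_def)
  note d = differences_tendsto_zero[OF kkt]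
  have W': "(\<lambda>n. w (Suc (r n))) \<longlonglongrightarrow> wb"
    using tendsto_add[OF sub[OF d(1)] wl] by (simp add: o_def)
  have X': "(\<lambda>n. x (Suc (r n))) \<longlonglongrightarrow> xb"
    using tendsto_add[OF sub[OF d(2)] xl] by (simp add: o_def)
  have Y': "(\<lambda>n. y (Suc (r n))) \<longlonglongrightarrow> yb"
    using tendsto_add[OF sub[OF d(3)] yl] by (simp add: o_def)
  have PY: "(\<lambda>n. P (y (Suc (r n)))) \<longlonglongrightarrow> 0"
    unfolding P_y_Suc using tendsto_scaleR[OF tendsto_const sub[OF d(1)], of "\<rho> / 2"] by simp
  have blA: "bounded_linear A" and blP: "bounded_linear P"
    using linA linP by (simp_all add: linear_conv_bounded_linear)
  have AX: "(\<lambda>n. A (x (Suc (r n)))) \<longlonglongrightarrow> A xb" by (rule bounded_linear.tendsto[OF blA X'])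
  have E: "(\<lambda>n. \<eta> (r n)) \<longlonglongrightarrow> yb"
    unfolding eta_eq using tendsto_add[OF Y' PY] by simp
  \<comment> \<open>\<open>P (y (Suc n))\<close> is a multiple of an increment of \<open>w\<close>
    and hence tends to 0.\<close>
  have "P yb = 0"
    using LIMSEQ_unique[OF bounded_linear.tendsto[OF blP Y'] PY] .
  then have orth: "yb \<bullet> u = 0" if "u \<in> W" for u using P_orth[OF that, of yb] by simp
  have "(\<lambda>n. A (x (Suc (r n))) - b) \<longlonglongrightarrow> (2 / \<rho>) *\<^sub>R 0 + wb"
    unfolding residual by (intro tendsto_intros sub d W')
  moreover have "(\<lambda>n. A (x (Suc (r n))) - b) \<longlonglongrightarrow> A xb - b"
    by (intro tendsto_intros AX)
  ultimately have feas: "A xb - b = wb"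
    by (metis LIMSEQ_unique scaleR_zero_right add_0)
  have wW: "wb \<in> W"
    by (rule closed_sequentially[OF closed_subspace[OF subW] _ wl]) (simp add: w_in)
  have epi: "xb \<in> C \<and> g xb \<le> g z + yb \<bullet> (A z - A xb)" if z: "z \<in> C" for z
  \<comment> \<open>\<open>C\<close> need not be closed, so membership of \<open>xb\<close> and the
    inequality are obtained together, as a limit of pairs in the closed epigraph.\<close>
  proof -
    let ?r = "\<lambda>n. g z + \<eta> n \<bullet> (A z - A (x (Suc n))) + (1 / c) * ((x (Suc n) - x n) \<bullet> (z - x (Suc n)))"
    have "(\<lambda>n. (x (Suc (r n)), ?r (r n)))
        \<longlonglongrightarrow> (xb, g z + yb \<bullet> (A z - A xb) + (1 / c) * (0 \<bullet> (z - xb)))"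
      by (intro tendsto_intros X' E AX sub d)
    then have "(xb, g z + yb \<bullet> (A z - A xb) + (1 / c) * (0 \<bullet> (z - xb))) \<in> {(z, r). z \<in> C \<and> g z \<le> r}"
      by (rule closed_sequentially[OF clo, rotated]) (use x_in x_optimality[OF z] in auto)
    then show ?thesis by simp
  qed
  \<comment> \<open>\<open>epi\<close> yields \<open>xb\<close> in \<open>C\<close> only from some
    given point of \<open>C\<close>; \<open>x 1\<close> serves as that point.\<close>
  show ?thesis
    unfolding kkt_def using wW feas orth epi epi[OF x_in[of 0]]
    by (auto simp: inner_diff_right inner_commute algebra_simps)
qed

lemma convergence:
  assumes kkt: "kkt w0 x0 y0"
  obtains wb xb yb where "kkt wb xb yb" "w \<longlonglongrightarrow> wb" "x \<longlonglongrightarrow> xb" "y \<longlonglongrightarrow> yb"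
proof -
  have le: "lyapunov w0 x0 y0 n \<le> lyapunov w0 x0 y0 0" for n
    using lyapunov_decseq[OF kkt] by (simp add: decseq_def)
  have pos: "0 \<le> 1 / \<rho> * (norm z)\<^sup>2" "0 \<le> \<rho> / 2 * (norm z)\<^sup>2" "0 \<le> 1 / (2 * c) * (norm z')\<^sup>2"
    for z :: 'b and z' :: 'a using rho c by simp_all
  have bdw: "bounded (range w)"
    by (rule bounded_if_weighted_sq_le[of "\<rho> / 2" _ w0 "lyapunov w0 x0 y0 0"])
      (use rho in simp, use le pos in \<open>unfold lyapunov_def, smt (verit)\<close>)
  have bdx: "bounded (range x)"
    by (rule bounded_if_weighted_sq_le[of "1 / (2 * c)" _ x0 "lyapunov w0 x0 y0 0"])
      (use c in simp, use le pos in \<open>unfold lyapunov_def, smt (verit)\<close>)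
  have bdy: "bounded (range y)"
    by (rule bounded_if_weighted_sq_le[of "1 / \<rho>" _ y0 "lyapunov w0 x0 y0 0"])
      (use rho in simp, use le pos in \<open>unfold lyapunov_def, smt (verit)\<close>)
  have "bounded (range (\<lambda>n. (w n, x n, y n)))"
    by (rule bounded_subset[OF bounded_Times[OF bdw bounded_Times[OF bdx bdy]]]) auto
  then obtain l r where r: "strict_mono r" and l: "((\<lambda>n. (w n, x n, y n)) \<circ> r) \<longlonglongrightarrow> l"
    using bounded_imp_convergent_subsequence by blast
  obtain wb xb yb where l_eq: "l = (wb, xb, yb)" by (cases l)
  have wl: "(w \<circ> r) \<longlonglongrightarrow> wb" and xl: "(x \<circ> r) \<longlonglongrightarrow> xb" and yl: "(y \<circ> r) \<longlonglongrightarrow> yb"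
    using tendsto_fst[OF l] tendsto_fst[OF tendsto_snd[OF l]] tendsto_snd[OF tendsto_snd[OF l]]
    by (simp_all add: l_eq o_def)
  have k: "kkt wb xb yb" by (rule cluster_point_kkt[OF kkt r wl xl yl])
  \<comment> \<open>\<open>P yb = 0\<close> is what makes the third term of \<open>lyapunov\<close>
    vanish along the subsequence.\<close>
  have "P yb \<in> W" by (rule P_in)
  then have "(yb - P yb) \<bullet> P yb = 0" "yb \<bullet> P yb = 0" using P_orth k by (auto simp: kkt_def)
  then have Py: "P yb = 0" by (simp add: inner_diff_left)
  have blP: "bounded_linear P" using linP by (simp add: linear_conv_bounded_linear)
  have "(\<lambda>n. lyapunov wb xb yb (r n)) \<longlonglongrightarrow> 1 / \<rho> * (norm (yb - yb))\<^sup>2 + \<rho> / 2 * (norm (wb - wb))\<^sup>2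
      + 1 / \<rho> * (norm (P yb))\<^sup>2 + 1 / (2 * c) * (norm (xb - xb))\<^sup>2"
    unfolding lyapunov_def
    by (intro tendsto_intros bounded_linear.tendsto[OF blP])
      (use wl xl yl in \<open>simp_all add: o_def\<close>)
  then have sub0: "(lyapunov wb xb yb \<circ> r) \<longlonglongrightarrow> 0" by (simp add: o_def Py)
  obtain l' where l': "lyapunov wb xb yb \<longlonglongrightarrow> l'"
    by (rule decseq_convergent[OF lyapunov_decseq[OF k], of 0]) (simp_all add: lyapunov_nonneg)
  have "l' = 0" using LIMSEQ_unique[OF LIMSEQ_subseq_LIMSEQ[OF l' r] sub0] .
  with l' have "lyapunov wb xb yb \<longlonglongrightarrow> 0" by simp
  from k lyapunov_zeroD[OF this] show ?thesis by (rule that)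
qed

end

section \<open>Coordinate blocks of a vector\<close>

lemma block_in_block_space: "block blk k x \<in> block_space blk k"
  by (simp add: block_def block_space_def)

lemma linear_block: "linear (block blk k)"
  by (rule linearI) (auto simp: block_def vec_eq_iff)

lemma sum_block:
  fixes x :: "real ^ 'n" and blk :: "'n::finite \<Rightarrow> 'k::finite"
  shows "(\<Sum>k\<in>UNIV. block blk k x) = x"
  by (simp add: block_def vec_eq_iff)

lemma block_block_space:
  assumes "z \<in> block_space blk k"
  shows "block blk j z = (if j = k then z else 0)"
  using assms by (auto simp: block_def block_space_def vec_eq_iff)

lemma block_sum:
  fixes blk :: "'n::finite \<Rightarrow> 'k::finite"
  assumes "\<And>k. z k \<in> block_space blk k"
  shows "block blk k (\<Sum>j\<in>UNIV. z j) = z k"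
proof -
  have "block blk k (\<Sum>j\<in>UNIV. z j) = (\<Sum>j\<in>UNIV. block blk k (z j))"
    by (rule linear_sum[OF linear_block])
  also have "\<dots> = (\<Sum>j\<in>UNIV. if k = j then z j else 0)"
    using block_block_space[OF assms] by (intro sum.cong) auto
  finally show ?thesis by simp
qed

lemma norm_sq_vec:
  fixes v :: "'a::real_inner ^ 'k::finite"
  shows "(norm v)\<^sup>2 = (\<Sum>k\<in>UNIV. (norm (v $ k))\<^sup>2)"
  unfolding power2_norm_eq_inner by (simp add: inner_vec_def)

text \<open>Every coordinate lies in exactly one block, so after swapping the sums one term per
  coordinate survives.\<close>

lemma norm_sq_blocks:
  fixes x :: "real ^ 'n" and blk :: "'n::finite \<Rightarrow> 'k::finite"
  shows "(norm x)\<^sup>2 = (\<Sum>k\<in>UNIV. (norm (block blk k x))\<^sup>2)"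
proof -
  have "(\<Sum>k\<in>UNIV. (norm (block blk k x))\<^sup>2) = (\<Sum>k\<in>UNIV. \<Sum>i\<in>UNIV. if blk i = k then (x $ i)\<^sup>2 else 0)"
    unfolding norm_sq_vec by (intro sum.cong) (auto simp: block_def)
  also have "\<dots> = (\<Sum>i\<in>UNIV. \<Sum>k\<in>UNIV. if blk i = k then (x $ i)\<^sup>2 else 0)"
    by (rule sum.swap)
  finally show ?thesis by (simp add: norm_sq_vec)
qed

section \<open>Lower semicontinuity in the extended reals\<close>

text \<open>For \<open>r\<close> strictly between \<open>y\<close> and \<open>g z\<close>, the point
  \<open>(z, r)\<close> lies in the open complement of the epigraph, hence so does
  \<open>(u n, r)\<close> eventually. Since \<open>u n\<close> is in \<open>V\<close>, this means
  \<open>g (u n) > r\<close>.\<close>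

lemma closed_epigraph_liminf:
  assumes clo: "closed (ereal_epigraph V g)" and "z \<in> V" and "\<And>n. u n \<in> V" and lim: "u \<longlonglongrightarrow> z"
  shows "g z \<le> liminf (\<lambda>n. g (u n))"
proof -
  have "eventually (\<lambda>n. y < g (u n)) sequentially" if y: "y < g z" for y
  proof -
    obtain r where r: "y < ereal r" "ereal r < g z" using ereal_dense2[OF y] by blast
    then have "(z, r) \<in> - ereal_epigraph V g" by (auto simp: ereal_epigraph_def)
    moreover have "(\<lambda>n. (u n, r)) \<longlonglongrightarrow> (z, r)" by (intro tendsto_intros lim)
    ultimately have "eventually (\<lambda>n. (u n, r) \<in> - ereal_epigraph V g) sequentially"
      using clo by (intro topological_tendstoD) auto
    then show ?thesis
      by eventually_elim (use r assms(3) in \<open>auto simp: ereal_epigraph_def not_le\<close>)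
  qed
  then show ?thesis by (simp add: le_Liminf_iff)
qed

text \<open>The second conjunct strengthens the induction: superadditivity of \<open>liminf\<close>
  must avoid the sum of opposite infinities.\<close>

lemma sum_liminf_le:
  fixes u :: "'i \<Rightarrow> nat \<Rightarrow> ereal"
  assumes "finite I" and "\<And>i. i \<in> I \<Longrightarrow> liminf (u i) \<noteq> -\<infinity>"
  shows "(\<Sum>i\<in>I. liminf (u i)) \<le> liminf (\<lambda>n. \<Sum>i\<in>I. u i n)
    \<and> (\<Sum>i\<in>I. liminf (u i)) \<noteq> -\<infinity>"
  using assms
proof (induction I rule: finite_induct)
  case empty
  then show ?case by (simp add: Liminf_const)
next
  case (insert j I)
  let ?s = "\<lambda>n. \<Sum>i\<in>I. u i n"
  have IH: "(\<Sum>i\<in>I. liminf (u i)) \<le> liminf ?s" "(\<Sum>i\<in>I. liminf (u i)) \<noteq> -\<infinity>"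
    using insert by auto
  have "liminf (u j) + (\<Sum>i\<in>I. liminf (u i)) \<le> liminf (u j) + liminf ?s"
    using IH by (intro add_left_mono)
  also have "\<dots> \<le> liminf (\<lambda>n. u j n + ?s n)"
    using IH insert.prems by (intro ereal_liminf_add_mono) auto
  finally show ?case using insert IH by simp
qed

section \<open>The separable program with real-valued objective\<close>

locale separable_program =
  fixes blk :: "'n::finite \<Rightarrow> 'k::{finite,linorder}"
    and f :: "'k \<Rightarrow> real ^ 'n \<Rightarrow> ereal"
    and X :: "'k \<Rightarrow> (real ^ 'n) set"
    and E :: "real ^ 'n ^ 'm::finite"
    and q :: "real ^ 'm"
  assumes f_cpc: "\<And>k. closed_proper_convex_on (block_space blk k) (f k)"
    and X_sub: "\<And>k. X k \<subseteq> block_space blk k"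
    and X_closed: "\<And>k. closed (X k)"
    and X_convex: "\<And>k. convex (X k)"
begin

abbreviation "F \<equiv> sep_fun blk f"
abbreviation "S \<equiv> prod_set blk X"

definition feas_dom :: "(real ^ 'n) set" where "feas_dom = S \<inter> eff_dom F"

text \<open>Meaningful only on \<open>eff_dom F\<close>, where it agrees with \<open>F\<close>:
  \<open>real_of_ereal\<close> sends infinite values to 0.\<close>

definition obj :: "real ^ 'n \<Rightarrow> real" where
  "obj x = (\<Sum>k\<in>UNIV. real_of_ereal (f k (block blk k x)))"

definition coupling :: "real ^ 'n \<Rightarrow> (real ^ 'm, 'k) vec" where
  "coupling x = (\<chi> k. E *v block blk k x)"

definition rhs :: "(real ^ 'm, 'k) vec" where "rhs = (\<chi> k. q_part q k)"

text \<open>The orthogonal projection onto \<open>W_space\<close>. The mean that it subtracts from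
  \<eta> is the \<zeta> of the algorithm.\<close>

definition proj_W :: "(real ^ 'm, 'k) vec \<Rightarrow> (real ^ 'm, 'k) vec" where
  "proj_W z = (\<chi> k. z $ k - (1 / real CARD('k)) *\<^sub>R (\<Sum>j\<in>UNIV. z $ j))"

lemma f_not_MInf: "z \<in> block_space blk k \<Longrightarrow> f k z \<noteq> -\<infinity>"
  using f_cpc[of k] by (simp add: closed_proper_convex_on_def)

text \<open>A finite sum excludes the value \<infinity> in every block, and properness excludes
  \<open>-\<infinity>\<close>.\<close>

lemma f_block_finite:
  assumes "x \<in> eff_dom F"
  shows "f k (block blk k x) = ereal (real_of_ereal (f k (block blk k x)))"
proof -
  have "F x \<noteq> \<infinity>" using assms by (auto simp: eff_dom_def)
  then have "f k (block blk k x) \<noteq> \<infinity>" by (auto simp: sep_fun_def sum_Pinfty)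
  with f_not_MInf[OF block_in_block_space, of k x] show ?thesis
    by (cases "f k (block blk k x)") auto
qed

lemma F_eq_obj: "x \<in> eff_dom F \<Longrightarrow> F x = ereal (obj x)"
  using f_block_finite by (simp add: sep_fun_def obj_def flip: sum_ereal)

lemma eff_domI:
  assumes "\<And>k. f k (block blk k x) < \<infinity>"
  shows "x \<in> eff_dom F"
proof -
  have "F x \<noteq> \<infinity>" using assms by (auto simp: sep_fun_def sum_Pinfty)
  then show ?thesis by (simp add: eff_dom_def)
qed

lemma feas_domD: "x \<in> feas_dom \<Longrightarrow> x \<in> S" "x \<in> feas_dom \<Longrightarrow> x \<in> eff_dom F"
  by (auto simp: feas_dom_def)

lemma closed_S: "closed S"
proof -
  have "S = (\<Inter>k. block blk k -` X k)" by (auto simp: prod_set_def)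
  then show ?thesis
    using X_closed
    by (auto intro!: closed_vimage linear_continuous_on
        simp: linear_block[unfolded linear_conv_bounded_linear])
qed

lemma convex_S: "convex S"
proof -
  have "S = (\<Inter>k. block blk k -` X k)" by (auto simp: prod_set_def)
  then show ?thesis
    using X_convex by (auto intro!: convex_INT convex_linear_vimage linear_block)
qed

text \<open>The set is the epigraph of \<open>F\<close> over \<open>S\<close>, because a real upper
  bound on \<open>F x\<close> already puts \<open>x\<close> in the effective domain. It is closed
  since \<open>S\<close> is closed and lower semicontinuity passes from the blocks to their
  sum.\<close>

lemma closed_epi: "closed {(x, r). x \<in> feas_dom \<and> obj x \<le> r}"
proof -
  have eq: "{(x, r). x \<in> feas_dom \<and> obj x \<le> r} = {(x, r). x \<in> S \<and> F x \<le> ereal r}"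
  proof -
    have "x \<in> feas_dom \<and> obj x \<le> r \<longleftrightarrow> x \<in> S \<and> F x \<le> ereal r" for x r
    proof
      assume "x \<in> S \<and> F x \<le> ereal r"
      then have "x \<in> feas_dom" "F x \<le> ereal r" by (auto simp: feas_dom_def eff_dom_def)
      then show "x \<in> feas_dom \<and> obj x \<le> r" using F_eq_obj feas_domD by simp
    qed (auto simp: F_eq_obj feas_domD)
    then show ?thesis by simp
  qed
  have "l \<in> {(x, r). x \<in> S \<and> F x \<le> ereal r}"
    if s: "\<And>n. s n \<in> {(x, r). x \<in> S \<and> F x \<le> ereal r}" and lim: "s \<longlonglongrightarrow> l" for s l
  proof -
    obtain x r where l: "l = (x, r)" by (cases l)
    define u t where "u n = fst (s n)" and "t n = snd (s n)" for n
    have u: "u n \<in> S" "F (u n) \<le> ereal (t n)" for n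
      using s[of n] by (auto simp: u_def t_def split: prod.splits)
    have ul: "u \<longlonglongrightarrow> x" and tl: "t \<longlonglongrightarrow> r"
      using tendsto_fst[OF lim] tendsto_snd[OF lim] by (simp_all add: l u_def[abs_def] t_def[abs_def])
    have xS: "x \<in> S" using closed_sequentially[OF closed_S _ ul] u by blast
    have lsc: "f k (block blk k x) \<le> liminf (\<lambda>n. f k (block blk k (u n)))" for k
      using f_cpc[of k] ul linear_block[of blk k]
      by (intro closed_epigraph_liminf[of "block_space blk k"])
        (auto simp: closed_proper_convex_on_def block_in_block_space linear_conv_bounded_linear
          intro: bounded_linear.tendsto)
    have "liminf (\<lambda>n. f k (block blk k (u n))) \<noteq> -\<infinity>" for k
      using lsc[of k] f_not_MInf[OF block_in_block_space, of k x] by auto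
    then have "(\<Sum>k\<in>UNIV. liminf (\<lambda>n. f k (block blk k (u n)))) \<le> liminf (\<lambda>n. F (u n))"
      unfolding sep_fun_def using sum_liminf_le[of UNIV "\<lambda>k n. f k (block blk k (u n))"] by simp
    moreover have "F x \<le> (\<Sum>k\<in>UNIV. liminf (\<lambda>n. f k (block blk k (u n))))"
      unfolding sep_fun_def by (intro sum_mono lsc)
    moreover have "liminf (\<lambda>n. F (u n)) \<le> liminf (\<lambda>n. ereal (t n))"
      by (intro Liminf_mono always_eventually allI u)
    moreover have "liminf (\<lambda>n. ereal (t n)) = ereal r"
      using tl by (intro lim_imp_Liminf) auto
    ultimately show ?thesis using xS l by (metis (mono_tags, lifting) case_prodI mem_Collect_eq order_trans)
  qed
  then show ?thesis unfolding eq closed_sequential_limits by blast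
qed

lemma f_convex:
  assumes "z \<in> block_space blk k" "z' \<in> block_space blk k" "0 \<le> s" "0 \<le> t" "s + t = 1"
    and "f k z = ereal r" "f k z' = ereal r'"
  shows "f k (s *\<^sub>R z + t *\<^sub>R z') \<le> ereal (s * r + t * r')"
proof -
  have "convex (ereal_epigraph (block_space blk k) (f k))"
    using f_cpc[of k] by (simp add: closed_proper_convex_on_def)
  moreover have "(z, r) \<in> ereal_epigraph (block_space blk k) (f k)"
    "(z', r') \<in> ereal_epigraph (block_space blk k) (f k)"
    using assms by (auto simp: ereal_epigraph_def)
  ultimately have "s *\<^sub>R (z, r) + t *\<^sub>R (z', r') \<in> ereal_epigraph (block_space blk k) (f k)"
    using assms by (intro convexD)
  then show ?thesis by (simp add: ereal_epigraph_def)
qed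

lemma convex_obj: "convex_on feas_dom obj"
proof -
  have key: "s *\<^sub>R x + t *\<^sub>R x' \<in> feas_dom \<and> obj (s *\<^sub>R x + t *\<^sub>R x') \<le> s * obj x + t * obj x'"
    if x: "x \<in> feas_dom" "x' \<in> feas_dom" and st: "0 \<le> s" "0 \<le> t" "s + t = 1" for x x' s t
  proof -
    let ?x = "s *\<^sub>R x + t *\<^sub>R x'"
    have b: "block blk k ?x = s *\<^sub>R block blk k x + t *\<^sub>R block blk k x'" for k
      by (simp add: linear_add[OF linear_block] linear_scale[OF linear_block])
    have le: "f k (block blk k ?x) \<le> ereal (s * real_of_ereal (f k (block blk k x))
        + t * real_of_ereal (f k (block blk k x')))" for k
      unfolding b using x st
      by (intro f_convex block_in_block_space f_block_finite feas_domD)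
    \<comment> \<open>Finiteness comes first: \<open>real_of_ereal\<close> would hide an infinite
      value at \<open>?x\<close>, so only inside the domain can the bound be read as one between
      reals.\<close>
    then have dom: "?x \<in> eff_dom F"
      by (intro eff_domI) (meson ereal_less_PInfty le_less_trans less_ereal.simps(4))
    have "?x \<in> S" using convexD[OF convex_S _ _ st] x feas_domD by blast
    moreover have "obj ?x \<le> (\<Sum>k\<in>UNIV. s * real_of_ereal (f k (block blk k x))
        + t * real_of_ereal (f k (block blk k x')))"
      unfolding obj_def
    proof (intro sum_mono)
      fix k
      show "real_of_ereal (f k (block blk k ?x)) \<le> s * real_of_ereal (f k (block blk k x))
        + t * real_of_ereal (f k (block blk k x'))"
        using le[of k] by (subst (asm) f_block_finite[OF dom]) simp
    qed
    ultimately show ?thesis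
      using dom by (simp add: obj_def feas_dom_def sum.distrib sum_distrib_left)
  qed
  then have "convex feas_dom" by (auto simp: convex_def)
  with key show ?thesis by (auto simp: convex_on_def)
qed

section \<open>Block constraints and the projection onto \<open>W_space\<close>\<close>

lemma linear_coupling: "linear coupling"
  unfolding coupling_def
  by (rule linearI) (simp_all add: vec_eq_iff linear_add[OF linear_block] linear_scale[OF linear_block]
      matrix_vector_right_distrib matrix_vector_mult_scaleR)

lemma sum_coupling: "(\<Sum>k\<in>UNIV. coupling x $ k) = E *v x"
proof -
  have "(\<Sum>k\<in>UNIV. coupling x $ k) = E *v (\<Sum>k\<in>UNIV. block blk k x)"
    by (simp add: coupling_def linear_sum[OF matrix_vector_mul_linear])
  then show ?thesis by (simp add: sum_block)
qed

lemma sum_rhs: "(\<Sum>k\<in>UNIV. rhs $ k) = q"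
  by (simp add: rhs_def q_part_def)

lemma inner_const:
  fixes v :: "(real ^ 'm, 'k) vec"
  shows "v \<bullet> (\<chi> k. u) = (\<Sum>k\<in>UNIV. v $ k) \<bullet> u"
  by (simp add: inner_vec_def[where 'b = 'k] inner_sum_left)

lemma linear_proj_W: "linear proj_W"
  unfolding proj_W_def
  by (rule linearI) (simp_all add: vec_eq_iff sum.distrib algebra_simps flip: scaleR_sum_right)

lemma subspace_W: "subspace (W_space :: ((real ^ 'm, 'k) vec) set)"
  by (auto simp: subspace_def W_space_def sum.distrib simp flip: scaleR_sum_right)

lemma proj_W_in: "proj_W z \<in> W_space"
  by (simp add: proj_W_def W_space_def sum_subtractf sum_constant_scaleR del: sum_constant)

lemma diff_proj_W: "z - proj_W z = (\<chi> k. (1 / real CARD('k)) *\<^sub>R (\<Sum>j\<in>UNIV. z $ j))"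
  by (simp add: proj_W_def vec_eq_iff)

lemma const_orth_W:
  fixes u :: "(real ^ 'm, 'k) vec"
  assumes "u \<in> W_space"
  shows "(\<chi> k. v) \<bullet> u = 0"
proof -
  have "(\<chi> k. v) \<bullet> u = (\<Sum>k\<in>UNIV. u $ k) \<bullet> v"
    by (subst inner_commute) (rule inner_const)
  then show ?thesis using assms by (simp add: W_space_def)
qed

lemma proj_W_orth: "u \<in> W_space \<Longrightarrow> (z - proj_W z) \<bullet> u = 0"
  unfolding diff_proj_W by (rule const_orth_W)

text \<open>Orthogonality makes \<open>proj_W y\<close> vanish, and \<open>y - proj_W y\<close> is
  constant by construction. This produces the common multiplier.\<close>

lemma orth_W_const:
  fixes y :: "(real ^ 'm, 'k) vec"
  assumes "\<forall>u\<in>W_space. y \<bullet> u = 0"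
  obtains ys where "y = (\<chi> k. ys)"
proof -
  have "proj_W y \<bullet> proj_W y = 0"
    using assms proj_W_in[of y] proj_W_orth[OF proj_W_in, of y y] by (simp add: inner_diff_left)
  then show ?thesis using diff_proj_W[of y] that by simp
qed

section \<open>Solvability of the block subproblems\<close>

text \<open>Pythagoras, over the components of the constraint vector and over the blocks of
  \<open>z\<close>. It identifies the independent block minimizations with one joint proximal
  step.\<close>

lemma proximal_objective_separable:
  fixes w y :: "(real ^ 'm, 'k) vec"
  shows "\<rho> / 4 * (norm (coupling z - (rhs + w - (2 / \<rho>) *\<^sub>R y)))\<^sup>2 + 1 / (2 * c) * (norm (z - a))\<^sup>2
    = (\<Sum>k\<in>UNIV. \<rho> / 4 * (norm (E *v block blk k z - q_part q k - w $ k + (2 / \<rho>) *\<^sub>R y $ k))\<^sup>2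
        + 1 / (2 * c) * (norm (block blk k z - block blk k a))\<^sup>2)"
proof -
  have "(norm (coupling z - (rhs + w - (2 / \<rho>) *\<^sub>R y)))\<^sup>2
      = (\<Sum>k\<in>UNIV. (norm (E *v block blk k z - q_part q k - w $ k + (2 / \<rho>) *\<^sub>R y $ k))\<^sup>2)"
    unfolding norm_sq_vec[where 'k = 'k] by (simp add: coupling_def rhs_def algebra_simps)
  moreover have "(norm (z - a))\<^sup>2 = (\<Sum>k\<in>UNIV. (norm (block blk k z - block blk k a))\<^sup>2)"
    by (subst norm_sq_blocks[of _ blk]) (simp add: linear_diff[OF linear_block])
  ultimately show ?thesis by (simp add: sum.distrib sum_distrib_left)
qed

text \<open>
  The affine minorant supplied by a saddle point makes the joint proximal problem solvable; the blocks
  of a joint minimizer solve the block problems, so the choice operator \<open>arg_min\<close> is harmless.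
\<close>

lemma assembled_block_mins:
  fixes w y :: "(real ^ 'm, 'k) vec" and a :: "real ^ 'n"
  assumes xb: "xb \<in> feas_dom"
    and minorant: "\<And>z. z \<in> feas_dom \<Longrightarrow> obj xb + coupling xb \<bullet> yb \<le> obj z + coupling z \<bullet> yb"
    and pos: "\<rho> > 0" "c > 0"
  defines "x' \<equiv> \<Sum>k\<in>UNIV. ada_block_min blk f X E q \<rho> c w a y k"
  shows "x' \<in> feas_dom"
    and "z \<in> feas_dom \<Longrightarrow>
      obj x' + \<rho> / 4 * (norm (coupling x' - (rhs + w - (2 / \<rho>) *\<^sub>R y)))\<^sup>2 + 1 / (2 * c) * (norm (x' - a))\<^sup>2
      \<le> obj z + \<rho> / 4 * (norm (coupling z - (rhs + w - (2 / \<rho>) *\<^sub>R y)))\<^sup>2 + 1 / (2 * c) * (norm (z - a))\<^sup>2"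
proof -
  define h where "h k z = \<rho> / 4 * (norm (E *v z - q_part q k - w $ k + (2 / \<rho>) *\<^sub>R y $ k))\<^sup>2
    + 1 / (2 * c) * (norm (z - block blk k a))\<^sup>2" for k z
  define tot where "tot z = obj z + \<rho> / 4 * (norm (coupling z - (rhs + w - (2 / \<rho>) *\<^sub>R y)))\<^sup>2
    + 1 / (2 * c) * (norm (z - a))\<^sup>2" for z
  have tot: "tot z = (\<Sum>k\<in>UNIV. real_of_ereal (f k (block blk k z)) + h k (block blk k z))" for z
    using proximal_objective_separable[of \<rho> z w y c a]
    by (simp add: tot_def obj_def h_def sum.distrib)
  obtain u where u: "u \<in> feas_dom" "\<And>z. z \<in> feas_dom \<Longrightarrow> tot u \<le> tot z"
    using proximal_minimizer_exists[OF closed_epi linear_coupling xb minorant, of "\<rho> / 4" "1 / (2 * c)"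
        "rhs + w - (2 / \<rho>) *\<^sub>R y" a] pos
    by (auto simp: tot_def)
  define H where "H k z = f k z + ereal (h k z)" for k z
  have H_real: "H k (block blk k z) = ereal (real_of_ereal (f k (block blk k z)) + h k (block blk k z))"
    if "z \<in> feas_dom" for k z
    unfolding H_def using f_block_finite[OF feas_domD(2)[OF that], of k]
    by (metis plus_ereal.simps(1))
  have u_min: "is_arg_min (H k) (\<lambda>z. z \<in> X k) (block blk k u)" for k
    unfolding is_arg_min_linorder
  proof (intro conjI allI impI)
    show "block blk k u \<in> X k" using u(1) by (auto simp: feas_dom_def prod_set_def)
    fix z assume z: "z \<in> X k"
    show "H k (block blk k u) \<le> H k z"
    proof (cases "f k z = \<infinity>")
      case False
      \<comment> \<open>The joint minimizer \<open>u\<close> is tested against \<open>v\<close>,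
        which differs from it in block \<open>k\<close> only, so all other summands cancel.\<close>
      define v where "v = (\<Sum>j\<in>UNIV. if j = k then z else block blk j u)"
      have bv: "block blk j v = (if j = k then z else block blk j u)" for j
        unfolding v_def using z X_sub[of k] by (intro block_sum) (auto simp: block_in_block_space)
      have v: "v \<in> feas_dom"
        unfolding feas_dom_def
      proof
        show "v \<in> S" using z u(1) by (auto simp: feas_dom_def prod_set_def bv)
        have "f j (block blk j u) < \<infinity>" for j
          by (subst f_block_finite[OF feas_domD(2)[OF u(1)]]) simp
        then show "v \<in> eff_dom F" using False by (intro eff_domI) (simp add: bv)
      qed
      have "tot u \<le> tot v" using u(2)[OF v] .
      then have "real_of_ereal (f k (block blk k u)) + h k (block blk k u)
          \<le> real_of_ereal (f k (block blk k v)) + h k (block blk k v)"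
        unfolding tot by (subst (asm) (1 2) sum.remove[of _ k]) (auto simp: bv)
      then have "H k (block blk k u) \<le> H k (block blk k v)"
        using H_real[OF u(1), of k] H_real[OF v, of k] by simp
      then show ?thesis by (simp add: bv)
    qed (simp add: H_def)
  qed
  define m where "m k = ada_block_min blk f X E q \<rho> c w a y k" for k
  have m_eq: "m k = arg_min (H k) (\<lambda>z. z \<in> X k)" for k
    by (simp add: m_def ada_block_min_def H_def[abs_def] h_def)
  have m_min: "is_arg_min (H k) (\<lambda>z. z \<in> X k) (m k)" for k
    unfolding m_eq arg_min_def using u_min by (rule someI)
  then have mX: "m k \<in> X k" and m_le: "H k (m k) \<le> H k (block blk k u)" for k
    using u_min[of k] by (auto simp: is_arg_min_linorder)
  have x': "x' = (\<Sum>k\<in>UNIV. m k)" by (simp add: x'_def m_def)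
  have bx: "block blk k x' = m k" for k
    unfolding x' using mX X_sub by (intro block_sum) blast
  show dom: "x' \<in> feas_dom"
    unfolding feas_dom_def
  proof
    show "x' \<in> S" using mX by (simp add: prod_set_def bx)
    have "f k (m k) \<noteq> \<infinity>" for k
      using m_le[of k] unfolding H_real[OF u(1)] by (auto simp: H_def)
    then show "x' \<in> eff_dom F" by (intro eff_domI) (simp add: bx)
  qed
  have "real_of_ereal (f k (block blk k x')) + h k (block blk k x')
      \<le> real_of_ereal (f k (block blk k u)) + h k (block blk k u)" for k
    using m_le[of k] unfolding bx[symmetric] H_real[OF dom] H_real[OF u(1)] by simp
  then have "tot x' \<le> tot u" unfolding tot by (intro sum_mono)
  then show "z \<in> feas_dom \<Longrightarrow>
      obj x' + \<rho> / 4 * (norm (coupling x' - (rhs + w - (2 / \<rho>) *\<^sub>R y)))\<^sup>2 + 1 / (2 * c) * (norm (x' - a))\<^sup>2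
      \<le> obj z + \<rho> / 4 * (norm (coupling z - (rhs + w - (2 / \<rho>) *\<^sub>R y)))\<^sup>2 + 1 / (2 * c) * (norm (z - a))\<^sup>2"
    using u(2)[of z] by (simp add: tot_def)
qed

section \<open>Saddle points and solutions of the primal and dual problems\<close>

lemma inner_coupling_const: "coupling x \<bullet> (\<chi> k. u) = (E *v x) \<bullet> u"
  by (simp only: inner_const sum_coupling)

text \<open>A point of \<open>feas_dom\<close> bounds the Lagrangian at \<open>xb\<close> by a
  finite value, so \<open>F xb\<close> is finite. Maximality in the multiplier then forces
  feasibility.\<close>

lemma saddle_point_optimality:
  assumes sp: "saddle_point F S E q xb ys" and ne: "feas_dom \<noteq> {}"
  shows "xb \<in> feas_dom" "E *v xb = q"
    "\<And>z. z \<in> feas_dom \<Longrightarrow>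
      obj xb + coupling xb \<bullet> (\<chi> k. ys) \<le> obj z + coupling z \<bullet> (\<chi> k. ys)"
proof -
  have xS: "xb \<in> S" and min: "\<And>z. z \<in> S \<Longrightarrow> lagrangian F E q xb ys \<le> lagrangian F E q z ys"
    and max: "\<And>y. lagrangian F E q xb y \<le> lagrangian F E q xb ys"
    using sp by (auto simp: saddle_point_def is_arg_min_linorder is_arg_max_linorder)
  obtain z0 where z0: "z0 \<in> feas_dom" using ne by blast
  have "lagrangian F E q xb ys \<le> lagrangian F E q z0 ys"
    using min feas_domD z0 by blast
  then have "F xb \<noteq> \<infinity>"
    using F_eq_obj[OF feas_domD(2)[OF z0]] by (auto simp: lagrangian_def)
  then show xb: "xb \<in> feas_dom" using xS by (simp add: feas_dom_def eff_dom_def)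
  have Fx: "F xb = ereal (obj xb)" using F_eq_obj feas_domD xb by blast
  \<comment> \<open>Shifting the multiplier by the residual raises the Lagrangian by the squared
    norm of the residual.\<close>
  have "(E *v xb - q) \<bullet> (ys + (E *v xb - q)) \<le> (E *v xb - q) \<bullet> ys"
    using max[of "ys + (E *v xb - q)"] by (simp add: lagrangian_def Fx)
  then have "(E *v xb - q) \<bullet> (E *v xb - q) \<le> 0" by (simp add: inner_add_right)
  then show "E *v xb = q" by (metis eq_iff_diff_eq_0 inner_eq_zero_iff inner_ge_zero order_antisym)
  fix z assume z: "z \<in> feas_dom"
  have "lagrangian F E q xb ys \<le> lagrangian F E q z ys" using min feas_domD z by blast
  then show "obj xb + coupling xb \<bullet> (\<chi> k. ys) \<le> obj z + coupling z \<bullet> (\<chi> k. ys)"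
    unfolding inner_coupling_const using Fx F_eq_obj[OF feas_domD(2)[OF z]]
    by (simp add: lagrangian_def inner_diff_left)
qed

lemma feasible_Pw_iff:
  "feasible_Pw blk S E q (w, x) \<longleftrightarrow> coupling x - rhs = w \<and> w \<in> W_space \<and> x \<in> S"
proof -
  have "(\<forall>j<Max UNIV. E *v block blk j x - w $ j = 0) \<and>
      E *v block blk (Max UNIV) x - q - w $ Max UNIV = 0 \<longleftrightarrow>
      (\<forall>j. E *v block blk j x - q_part q j = w $ j)"
    (is "?l \<longleftrightarrow> ?r")
  proof
    assume l: ?l
    show ?r
    proof
      fix j
      show "E *v block blk j x - q_part q j = w $ j"
      proof (cases "j = Max UNIV")
        case False
        then have "j < Max UNIV" by (simp add: order.not_eq_order_implies_strict)
        with l False show ?thesis by (simp add: q_part_def)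
      qed (use l in \<open>simp add: q_part_def\<close>)
    qed
  next
    assume r: ?r
    show ?l
    proof (intro conjI allI impI)
      fix j :: 'k assume "j < Max UNIV"
      then have "j \<noteq> Max UNIV" by blast
      then show "E *v block blk j x - w $ j = 0" using spec[OF r, of j] by (simp add: q_part_def)
    qed (use spec[OF r, of "Max UNIV"] in \<open>simp add: q_part_def\<close>)
  qed
  then show ?thesis
    unfolding feasible_Pw_def W_space_def
    by (auto simp: coupling_def rhs_def vec_eq_iff[where 'b = 'k])
qed

text \<open>Summing the block constraints eliminates \<open>w\<close>.\<close>

lemma feasible_Pw_imp: "feasible_Pw blk S E q (w, x) \<Longrightarrow> x \<in> S \<and> E *v x = q"
proof -
  assume "feasible_Pw blk S E q (w, x)"
  then have w: "coupling x - rhs \<in> W_space" "x \<in> S" unfolding feasible_Pw_iff by auto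
  then have "(\<Sum>k\<in>UNIV. coupling x $ k) - (\<Sum>k\<in>UNIV. rhs $ k) = 0"
    by (simp add: W_space_def sum_subtractf)
  with w show ?thesis by (simp add: sum_coupling sum_rhs)
qed

text \<open>Since \<open>E *v xb = q\<close>, minimality of the Lagrangian becomes the bound
  \<open>le\<close> on all of \<open>S\<close>. On feasible points it is primal optimality; its
  infimum over \<open>S\<close> gives \<open>F xb\<close> \<le> \<open>dual_fun F S E q ys\<close>,
  and weak duality completes the dual claim.\<close>

lemma optimality_imp_solutions:
  assumes feas: "feasible_Pw blk S E q (wb, xb)" and dom: "xb \<in> feas_dom"
    and min: "\<And>z. z \<in> feas_dom \<Longrightarrow>
      obj xb + coupling xb \<bullet> (\<chi> k. ys) \<le> obj z + coupling z \<bullet> (\<chi> k. ys)"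
  shows "solves_Pw blk F S E q wb xb" "solves_P F S E q xb" "solves_D F S E q ys"
proof -
  have xb: "xb \<in> S" "E *v xb = q" using feasible_Pw_imp[OF feas] by auto
  have Fx: "F xb = ereal (obj xb)" using F_eq_obj feas_domD dom by blast
  have le: "F xb \<le> F z + ereal (ys \<bullet> (E *v z - q))" if "z \<in> S" for z
  proof (cases "F z = \<infinity>")
    case False
    then have z: "z \<in> feas_dom" using that by (simp add: feas_dom_def eff_dom_def)
    show ?thesis
      using min[OF z] F_eq_obj[OF feas_domD(2)[OF z]] Fx xb(2)
      unfolding inner_coupling_const by (simp add: inner_diff_right inner_commute)
  qed simp
  have opt: "F xb \<le> F z" if "z \<in> S" "E *v z = q" for z
    using le[OF that(1)] that(2) by (simp add: zero_ereal_def[symmetric])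
  show "solves_P F S E q xb"
    using xb opt by (auto simp: solves_P_def is_arg_min_linorder)
  show "solves_Pw blk F S E q wb xb"
    using feas opt feasible_Pw_imp by (auto simp: solves_Pw_def is_arg_min_linorder)
  show "solves_D F S E q ys"
    unfolding solves_D_def is_arg_max_linorder
  proof (intro conjI allI impI TrueI)
    fix y
    \<comment> \<open>Weak duality: \<open>xb\<close> competes in the infimum and its constraint
      term vanishes.\<close>
    have "dual_fun F S E q y \<le> F xb + ereal (y \<bullet> (E *v xb - q))"
      unfolding dual_fun_def using xb(1) by (rule INF_lower)
    also have "\<dots> = F xb" using xb(2) by (simp add: zero_ereal_def[symmetric])
    also have "\<dots> \<le> dual_fun F S E q ys"
      unfolding dual_fun_def by (intro INF_greatest le)
    finally show "dual_fun F S E q y \<le> dual_fun F S E q ys" .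
  qed
qed

section \<open>Convergence of the decomposition algorithm\<close>

lemma ada_convergence:
  fixes w0 y0 :: "(real ^ 'm, 'k) vec"
  assumes sp: "saddle_point F S E q xs ys" and ne: "feas_dom \<noteq> {}"
    and pos: "\<rho> > 0" "c > 0" and w0: "w0 \<in> W_space" and x0: "x0 \<in> S"
  shows "\<forall>\<nu>. ada blk f X E q \<rho> c (w0, x0, y0) \<nu> \<in> W_space \<times> S \<times> UNIV"
    and "\<exists>wb xb yb. ada blk f X E q \<rho> c (w0, x0, y0) \<longlonglongrightarrow> (wb, xb, yb) \<and>
       solves_Pw blk F S E q wb xb \<and> solves_P F S E q xb \<and>
       (\<exists>ys. (\<forall>k. yb $ k = ys) \<and> solves_D F S E q ys)"
proof -
  note opt = saddle_point_optimality[OF sp ne]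
  define s where "s = ada blk f X E q \<rho> c (w0, x0, y0)"
  define w x y where "w n = fst (s n)" and "x n = fst (snd (s n))" and "y n = snd (snd (s n))" for n
  have s_eq: "s n = (w n, x n, y n)" for n by (simp add: w_def x_def y_def)
  have s_0: "s 0 = (w0, x0, y0)" by (simp add: s_def ada_def)
  define \<eta> where "\<eta> n = y n + (\<rho> / 2) *\<^sub>R (coupling (x (Suc n)) - rhs - w n)" for n
  have s_Suc: "s (Suc n) = ada_step blk f X E q \<rho> c (w n, x n, y n)" for n
    unfolding s_eq[symmetric] by (simp add: s_def ada_def)
  have x_Suc: "x (Suc n) = (\<Sum>k\<in>UNIV. ada_block_min blk f X E q \<rho> c (w n) (x n) (y n) k)" for n
    by (simp add: x_def[of "Suc n"] s_Suc ada_step_def Let_def)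
  have eta_eq: "\<eta> n = (\<chi> k. y n $ k + (\<rho> / 2) *\<^sub>R (E *v block blk k (x (Suc n)) - q_part q k - w n $ k))" for n
    by (simp add: \<eta>_def coupling_def rhs_def vec_eq_iff[where 'b = 'k])
  have w_Suc: "w (Suc n) = w n + (1 / \<rho>) *\<^sub>R proj_W (\<eta> n)" for n
    unfolding eta_eq
    by (simp add: w_def[of "Suc n"] s_Suc ada_step_def Let_def x_Suc proj_W_def vec_eq_iff[where 'b = 'k])
  have y_Suc': "y (Suc n) $ k = (1 / 2) *\<^sub>R (\<eta> n $ k + (1 / real CARD('k)) *\<^sub>R (\<Sum>j\<in>UNIV. \<eta> n $ j))" for n k
    unfolding eta_eq
    by (simp add: y_def[of "Suc n"] s_Suc ada_step_def Let_def x_Suc)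
  \<comment> \<open>With \<open>m\<close> the mean \<zeta>, this rewrites the averaging update of
    \<open>y\<close> as a correction by the projection of \<eta>.\<close>
  have half: "(1 / 2) *\<^sub>R (a + m) = a - (1 / 2) *\<^sub>R (a - m)" for a m :: "real ^ 'm"
    by (simp add: vec_eq_iff field_simps)
  have y_Suc: "y (Suc n) = \<eta> n - (1 / 2) *\<^sub>R proj_W (\<eta> n)" for n
    unfolding vec_eq_iff[where 'b = 'k] by (simp add: y_Suc' proj_W_def half del: scaleR_right_diff_distrib)
  interpret augmented_decomposition feas_dom obj coupling W_space proj_W rhs \<rho> c w y \<eta> x
  proof (rule augmented_decomposition.intro)
    show "w 0 \<in> W_space" using w0 by (simp add: w_def s_0)
    show "x (Suc n) \<in> feas_dom" for n
      unfolding x_Suc by (rule assembled_block_mins(1)[OF opt(1,3) pos])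
    show "obj (x (Suc n)) + \<rho> / 4 * (norm (coupling (x (Suc n)) - (rhs + w n - (2 / \<rho>) *\<^sub>R y n)))\<^sup>2
        + 1 / (2 * c) * (norm (x (Suc n) - x n))\<^sup>2
      \<le> obj z + \<rho> / 4 * (norm (coupling z - (rhs + w n - (2 / \<rho>) *\<^sub>R y n)))\<^sup>2
        + 1 / (2 * c) * (norm (z - x n))\<^sup>2" if "z \<in> feas_dom" for n z
      unfolding x_Suc by (rule assembled_block_mins(2)[OF opt(1,3) pos]) (simp_all add: that)
  qed (use pos in \<open>simp_all add: convex_obj closed_epi linear_coupling linear_proj_W subspace_W
      proj_W_in proj_W_orth \<eta>_def w_Suc y_Suc\<close>)
  \<comment> \<open>The start \<open>x0\<close> may have infinite objective, so it is treated apart;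
    later iterates lie in \<open>feas_dom\<close>.\<close>
  have "x n \<in> S" for n
    using x0 x_in feas_domD(1) by (cases n) (auto simp: x_def[of 0] s_0)
  then show "\<forall>\<nu>. ada blk f X E q \<rho> c (w0, x0, y0) \<nu> \<in> W_space \<times> S \<times> UNIV"
    unfolding s_def[symmetric] using w_in by (simp add: s_eq)
  \<comment> \<open>The components sum to \<open>E *v xs - q\<close>, which is 0. Thus the given
    saddle point yields a reference triple, with the multiplier repeated in every block.\<close>
  have "coupling xs - rhs \<in> W_space"
    using opt(2) by (simp add: W_space_def sum_subtractf sum_coupling sum_rhs)
  then have "kkt (coupling xs - rhs) xs (\<chi> k. ys)"
    unfolding kkt_def using opt(1,3) const_orth_W by blast
  then obtain wb xb yb where k: "kkt wb xb yb" and lim: "w \<longlonglongrightarrow> wb" "x \<longlonglongrightarrow> xb" "y \<longlonglongrightarrow> yb"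
    by (rule convergence)
  have "s \<longlonglongrightarrow> (wb, xb, yb)"
    unfolding s_eq[abs_def] using lim by (intro tendsto_Pair)
  moreover have "\<forall>u\<in>W_space. yb \<bullet> u = 0" using k by (simp add: kkt_def)
  then obtain us where yb: "yb = (\<chi> k. us)" by (rule orth_W_const)
  moreover have "feasible_Pw blk S E q (wb, xb)" "xb \<in> feas_dom"
    using k feas_domD(1) by (auto simp: kkt_def feasible_Pw_iff)
  moreover have "obj xb + coupling xb \<bullet> (\<chi> k. us) \<le> obj z + coupling z \<bullet> (\<chi> k. us)"
    if "z \<in> feas_dom" for z using k that by (simp add: kkt_def yb)
  ultimately have "s \<longlonglongrightarrow> (wb, xb, yb) \<and> solves_Pw blk F S E q wb xb \<and> solves_P F S E q xb \<and>
      (\<forall>k. yb $ k = us) \<and> solves_D F S E q us"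
    using optimality_imp_solutions[of wb xb us] yb by simp
  then show "\<exists>wb xb yb. ada blk f X E q \<rho> c (w0, x0, y0) \<longlonglongrightarrow> (wb, xb, yb) \<and>
       solves_Pw blk F S E q wb xb \<and> solves_P F S E q xb \<and>
       (\<exists>ys. (\<forall>k. yb $ k = ys) \<and> solves_D F S E q ys)"
    unfolding s_def by blast
qed

end

theorem theorem2p2:
  fixes blk :: "'n::finite \<Rightarrow> 'k::{finite,linorder}"
    and f :: "'k \<Rightarrow> real ^ 'n \<Rightarrow> ereal"
    and X :: "'k \<Rightarrow> (real ^ 'n) set"
    and E :: "real ^ 'n ^ 'm::finite"
    and q :: "real ^ 'm"
    and \<rho> c :: real
    and w0 y0 :: "(real ^ 'm, 'k) vec"
    and x0 :: "real ^ 'n"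
  assumes f_cpc: "\<And>k. closed_proper_convex_on (block_space blk k) (f k)"
    and X_sub: "\<And>k. X k \<subseteq> block_space blk k"
    and X_closed: "\<And>k. closed (X k)"
    and X_convex: "\<And>k. convex (X k)"
    and min_attained: "\<exists>x. solves_P (sep_fun blk f) (prod_set blk X) E q x"
    and cq: "constraint_qualification (sep_fun blk f) (prod_set blk X) E q"
    and saddle: "\<exists>x y. saddle_point (sep_fun blk f) (prod_set blk X) E q x y"
    and rho_pos: "\<rho> > 0"
    and c_pos: "c > 0"
    and w0: "w0 \<in> W_space"
    and x0: "x0 \<in> prod_set blk X"
  shows "(\<forall>\<nu>. ada blk f X E q \<rho> c (w0, x0, y0) \<nu> \<in> W_space \<times> prod_set blk X \<times> UNIV) \<and>
    (\<exists>wb xb yb.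
       ada blk f X E q \<rho> c (w0, x0, y0) \<longlonglongrightarrow> (wb, xb, yb) \<and>
       solves_Pw blk (sep_fun blk f) (prod_set blk X) E q wb xb \<and>
       solves_P (sep_fun blk f) (prod_set blk X) E q xb \<and>
       (\<exists>ys. (\<forall>k. yb $ k = ys) \<and> solves_D (sep_fun blk f) (prod_set blk X) E q ys))"
proof -
  interpret separable_program blk f X E q
    using f_cpc X_sub X_closed X_convex by unfold_locales
  \<comment> \<open>Either alternative of the constraint qualification contains a point of the
    constraint set with finite objective, since an interior is part of its set.\<close>
  have ne: "feas_dom \<noteq> {}"
    using cq interior_subset unfolding constraint_qualification_def feas_dom_def by blast
  obtain xs ys where sp: "saddle_point (sep_fun blk f) (prod_set blk X) E q xs ys"
    using saddle by blast
  show ?thesis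
    using ada_convergence[OF sp ne rho_pos c_pos w0 x0, of y0] by (rule conjI)
qed

end
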